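(* Let $r>s>0$ be integers and $\underline{x}=(x_2,\ldots,x_r)$ a tuple of elements of $\{0,1\}$. The power series $\Phi_w\in 1+Y\mathbb{Z}[[X,Y]]$ for all $w\in\Gamma_{\underline{x}}$ are rational functions with the lowest common denominator $$D_{\underline{x}}\ :=\ (1-2Y)\cdot\prod_{0\le\ell\le s}D_{\underline{x},\ell}\ \in\ 1+Y\mathbb{Z}[X,Y].$$
   Context: Let $T$ be the infinite rooted regular binary tree whose vertices are the finite words over $\{0,1\}$, with root the empty word, each word $t$ being joined by an edge to the words $0t$ and $1t$. Level $n$ of $T$ is the set of words of length $n$. Let $W=\mathrm{Aut}(T)$ be the automorphism group of $T$ (products are compositions, $(uv)(t)=u(v(t))$), with identity element $1$. For $u,v\in W$, let $(u,v)\in W$ be the automorphism fixing the root and given by $t0\mapsto u(t)0$ and $t1\mapsto v(t)1$ for every word $t$. Let $\sigma\in W$ be the involution fixing the root with $t0\mapsto t1$ and $t1\mapsto t0$ for every word $t$. For $w\in W$, every orbit of $w$ on level $n$ has length $2^m$ for some $0\le m\le n$. The orbit length generating function of $w$ is $\Phi_w=\sum_{n\ge m\ge 0}o_{m,n}(w)X^mY^n$, where $o_{m,n}(w)$ is the number of orbits of $w$ of length $2^m$ on level $n$. Let $b_1,\ldots,b_r\in W$ be the elements determined by the recursion relations $b_1=\sigma$; $b_{s+1}=(b_r,b_s)$ if $x_{s+1}=0$; $b_{s+1}=(b_s,b_r)$ if $x_{s+1}=1$; $b_i=(b_{i-1},1)$ for all $i\ne1,s+1$ with $x_i=0$; $b_i=(1,b_{i-1})$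 for all $i\neq1,s+1$ with $x_i=1$. Let $\Gamma_{\underline{x}}\subset W$ be the subgroup generated by $b_1,\ldots,b_r$. Let $\pi$ be the permutation of $\{1,\ldots,r\}$ with $\pi(1)=s$, $\pi(s+1)=r$, and $\pi(i)=i-1$ otherwise. Consider the following conditions on a subset $J\subset\{1,\ldots,r\}$, for all $n\ge0$: (a) if $1\in\pi^n(J)$, then $s+1\in\pi^n(J)$; (b) if $1\notin\pi^n(J)$, then the values $x_i$ are equal for all $i\in\pi^n(J)$. For $J\subset\{1,\ldots,r\}$ and $m\ge0$ let $\ell_m$ be the number of integers $0\le i<m$ with $1\in\pi^i(J)$, and set $$\Psi_J:=\sum_{m\ge0,\ 1\in\pi^m(J)}X^{\ell_m}Y^{m+1}\ +\sum_{m\ge0,\ 1\notin\pi^m(J)\ni s+1}X^{\ell_m}Y^{m+s+1},$$ which is the expansion of a rational function. The lowest common denominator of a set $S$ of rational functions in $X,Y$ (having a common denominator) is the generator, up to sign, of the ideal $\{D\in\mathbb{Z}[X,Y] : D f\in\mathbb{Z}[X,Y]\ \text{for all } f\in S\}$; here it is normalized to lie in $1+Y\mathbb{Z}[X,Y]$ (and it is $1$ if $S$ is empty). For $0\le\ell\le s$, $D_{\underline{x},\ell}$ denotes the lowest common denominator of the $\Psi_J$ for all $J\subset\{1,\ldots,r\}$ with $\ell=|\{i\in J\mid i\le s\}|$ satisfying conditions (a) and (b). *)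

theory Defs
  imports
    "HOL-Algebra.Generated_Groups"
    "HOL-Combinatorics.Orbits"
    "HOL-Computational_Algebra.Polynomial_FPS"
begin

section \<open>The binary tree and its automorphism group\<close>

text \<open>
  The letters 0 and 1 are \<^const>\<open>False\<close> and \<^const>\<open>True\<close>.  The children of a vertex \<open>t\<close> are the
  words \<open>0t\<close> and \<open>1t\<close>, so the head of the list is the letter farthest from the root, and the
  \<^emph>\<open>last\<close> letter of a word decides which half of the tree it lies in.
\<close>

type_synonym vertex = "bool list"

definition edge :: "vertex \<Rightarrow> vertex \<Rightarrow> bool" where
  "edge t t' \<longleftrightarrow> (\<exists>a. t' = a # t) \<or> (\<exists>a. t = a # t')"

definition tree_auts :: "(vertex \<Rightarrow> vertex) set" where
  "tree_auts = {f. bij f \<and> f [] = [] \<and> (\<forall>t t'. edge (f t) (f t') \<longleftrightarrow> edge t t')}"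

definition W :: "(vertex \<Rightarrow> vertex) monoid" where
  "W = \<lparr>carrier = tree_auts, monoid.mult = (\<circ>), one = id\<rparr>"

definition aut_pair :: "(vertex \<Rightarrow> vertex) \<Rightarrow> (vertex \<Rightarrow> vertex) \<Rightarrow> vertex \<Rightarrow> vertex" where
  "aut_pair u v w =
     (if w = [] then []
      else if last w then v (butlast w) @ [True]
      else u (butlast w) @ [False])"

definition swap :: "vertex \<Rightarrow> vertex" where
  "swap w = (if w = [] then [] else butlast w @ [\<not> last w])"


section \<open>The generators\<close>

text \<open>Only the values \<open>x 2, \<dots>, x r\<close> and \<open>b 1, \<dots>, b r\<close> are used below.\<close>

definition recursion_relations ::
    "nat \<Rightarrow> nat \<Rightarrow> (nat \<Rightarrow> bool) \<Rightarrow> (nat \<Rightarrow> vertex \<Rightarrow> vertex) \<Rightarrow> bool" where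
  "recursion_relations r s x b \<longleftrightarrow>
     (\<forall>i\<in>{1..r}. b i \<in> carrier W) \<and>
     b 1 = swap \<and>
     (x (s + 1) = False \<longrightarrow> b (s + 1) = aut_pair (b r) (b s)) \<and>
     (x (s + 1) = True \<longrightarrow> b (s + 1) = aut_pair (b s) (b r)) \<and>
     (\<forall>i\<in>{1..r} - {1, s + 1}.
        (x i = False \<longrightarrow> b i = aut_pair (b (i - 1)) id) \<and>
        (x i = True \<longrightarrow> b i = aut_pair id (b (i - 1))))"

definition Gam :: "nat \<Rightarrow> (nat \<Rightarrow> vertex \<Rightarrow> vertex) \<Rightarrow> (vertex \<Rightarrow> vertex) set" where
  "Gam r b = generate W (b ` {1..r})"


section \<open>Polynomials and power series in two variables\<close>

text \<open>
  \<open>\<int>[X,Y]\<close> is \<^typ>\<open>int poly poly\<close> and \<open>\<int>[[X,Y]]\<close> is \<^typ>\<open>int fps fps\<close>; in both, \<open>Y\<close> is the outer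
  variable.
\<close>

abbreviation PY :: "int poly poly" where
  "PY \<equiv> [:0, 1:]"

definition series_of_poly :: "int poly poly \<Rightarrow> int fps fps" where
  "series_of_poly p = fps_of_poly (map_poly fps_of_poly p)"

definition is_rational :: "int fps fps \<Rightarrow> bool" where
  "is_rational f \<longleftrightarrow> (\<exists>N D. D \<noteq> 0 \<and> series_of_poly D * f = series_of_poly N)"

definition denominator_ideal :: "int fps fps set \<Rightarrow> int poly poly set" where
  "denominator_ideal S = {D. \<forall>f\<in>S. series_of_poly D * f \<in> range series_of_poly}"

text \<open>
  The first condition says that \<open>D\<close> generates the ideal of common denominators, the second one
  that \<open>D\<close> lies in \<open>1 + Y \<int>[X,Y]\<close>; in particular \<open>D \<noteq> 0\<close>, so the members of \<open>S\<close> do have a common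
  denominator.
\<close>

definition is_lcd :: "int fps fps set \<Rightarrow> int poly poly \<Rightarrow> bool" where
  "is_lcd S D \<longleftrightarrow> denominator_ideal S = {E. D dvd E} \<and> coeff D 0 = 1"

definition lcd :: "int fps fps set \<Rightarrow> int poly poly" where
  "lcd S = (THE D. is_lcd S D)"


section \<open>Orbit length generating functions\<close>

definition orbit_count :: "(vertex \<Rightarrow> vertex) \<Rightarrow> nat \<Rightarrow> nat \<Rightarrow> nat" where
  "orbit_count w m n = card {orbit w t | t. length t = n \<and> card (orbit w t) = 2 ^ m}"

definition Phi :: "(vertex \<Rightarrow> vertex) \<Rightarrow> int fps fps" where
  "Phi w = Abs_fps (\<lambda>n. Abs_fps (\<lambda>m. if m \<le> n then int (orbit_count w m n) else 0))"


section \<open>The denominators\<close>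

definition perm :: "nat \<Rightarrow> nat \<Rightarrow> nat \<Rightarrow> nat" where
  "perm r s i = (if i = 1 then s else if i = s + 1 then r else i - 1)"

abbreviation perm_pow :: "nat \<Rightarrow> nat \<Rightarrow> nat \<Rightarrow> nat set \<Rightarrow> nat set" where
  "perm_pow r s n J \<equiv> (perm r s ^^ n) ` J"

definition admissible :: "nat \<Rightarrow> nat \<Rightarrow> (nat \<Rightarrow> bool) \<Rightarrow> nat set \<Rightarrow> bool" where
  "admissible r s x J \<longleftrightarrow>
     (\<forall>n. (1 \<in> perm_pow r s n J \<longrightarrow> s + 1 \<in> perm_pow r s n J) \<and>
          (1 \<notin> perm_pow r s n J \<longrightarrow>
             (\<forall>i\<in>perm_pow r s n J. \<forall>j\<in>perm_pow r s n J. x i = x j)))"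

definition ell :: "nat \<Rightarrow> nat \<Rightarrow> nat set \<Rightarrow> nat \<Rightarrow> nat" where
  "ell r s J m = card {i. i < m \<and> 1 \<in> perm_pow r s i J}"

text \<open>
  The coefficient of \<open>Y\<^sup>n\<close> collects the (at most two) terms of the series with that exponent of
  \<open>Y\<close>; all of them have index \<open>m < n\<close>.
\<close>

definition Psi :: "nat \<Rightarrow> nat \<Rightarrow> nat set \<Rightarrow> int fps fps" where
  "Psi r s J = Abs_fps (\<lambda>n.
     (\<Sum>m | m < n \<and> n = m + 1 \<and> 1 \<in> perm_pow r s m J. fps_X ^ ell r s J m) +
     (\<Sum>m | m < n \<and> n = m + s + 1 \<and> 1 \<notin> perm_pow r s m J \<and> s + 1 \<in> perm_pow r s m J.
        fps_X ^ ell r s J m))"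

definition D_part :: "nat \<Rightarrow> nat \<Rightarrow> (nat \<Rightarrow> bool) \<Rightarrow> nat \<Rightarrow> int poly poly" where
  "D_part r s x l =
     lcd {Psi r s J | J. J \<subseteq> {1..r} \<and> card {i \<in> J. i \<le> s} = l \<and> admissible r s x J}"

definition D_total :: "nat \<Rightarrow> nat \<Rightarrow> (nat \<Rightarrow> bool) \<Rightarrow> int poly poly" where
  "D_total r s x = (1 - 2 * PY) * (\<Prod>l\<in>{0..s}. D_part r s x l)"


section \<open>Well-definedness\<close>

lemma group_W: "group W"
proof (rule groupI)
  fix f assume "f \<in> carrier W"
  then have f: "bij f" "f [] = []" "\<And>t t'. edge (f t) (f t') \<longleftrightarrow> edge t t'"
    by (auto simp: W_def tree_auts_def)
  have "the_inv f \<in> tree_auts"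
    unfolding tree_auts_def
  proof (intro CollectI conjI allI)
    show "bij (the_inv f)" using f(1) by (metis bij_betw_the_inv_into)
    show "the_inv f [] = []" using f(1,2) by (metis bij_is_inj the_inv_f_f)
    show "edge (the_inv f t) (the_inv f t') \<longleftrightarrow> edge t t'" for t t'
      using f(1,3) by (metis bij_betw_def f_the_inv_into_f UNIV_I)
  qed
  moreover have "the_inv f \<circ> f = id"
    using f(1) by (auto simp: fun_eq_iff bij_is_inj the_inv_f_f)
  ultimately show "\<exists>g\<in>carrier W. g \<otimes>\<^bsub>W\<^esub> f = \<one>\<^bsub>W\<^esub>"
    by (auto simp: W_def)
qed (auto simp: W_def tree_auts_def bij_comp comp_assoc)

text \<open>An explicit solution of the recursion relations, acting on reversed words.\<close>

fun rev_gen :: "nat \<Rightarrow> nat \<Rightarrow> (nat \<Rightarrow> bool) \<Rightarrow> nat \<Rightarrow> vertex \<Rightarrow> vertex" where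
  "rev_gen r s x i [] = []"
| "rev_gen r s x i (a # t) =
     (if i = 1 then (\<not> a) # t
      else if i = s + 1 then a # rev_gen r s x (if a = x i then r else s) t
      else if a = x i then a # rev_gen r s x (i - 1) t
      else a # t)"

lemma rev_gen_involution: "rev_gen r s x i (rev_gen r s x i t) = t"
  by (induction t arbitrary: i) auto

lemma rev_gen_snoc: "\<exists>c. rev_gen r s x i (t @ [a]) = rev_gen r s x i t @ [c]"
  by (induction t arbitrary: i) auto

lemma ex_recursion_relations:
  assumes "0 < s" "s < r"
  shows "\<exists>b. recursion_relations r s x b"
proof -
  define b where "b = (\<lambda>i w. rev (rev_gen r s x i (rev w)))"
  have inv: "b i (b i w) = w" for i w
    by (simp add: b_def rev_gen_involution)
  have child: "\<exists>c. b i (a # t) = c # b i t" for i a t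
    using rev_gen_snoc[of r s x i "rev t" a] by (auto simp: b_def)
  have edge: "edge (b i t) (b i t')" if "edge t t'" for i t t'
    using that child unfolding edge_def by metis
  have "b i \<in> carrier W" for i
    unfolding W_def tree_auts_def
    using inv edge by (auto simp: b_def intro!: involuntory_imp_bij) (metis b_def inv)+
  moreover have snoc: "w = [] \<or> (\<exists>t a. w = t @ [a])" for w :: vertex
    by (cases w rule: rev_cases) auto
  have "b 1 = swap"
    using snoc by (fastforce simp: b_def swap_def fun_eq_iff)
  moreover have "b (s + 1) = (if x (s + 1) then aut_pair (b s) (b r) else aut_pair (b r) (b s))"
  proof
    fix w show "b (s + 1) w = (if x (s + 1) then aut_pair (b s) (b r) else aut_pair (b r) (b s)) w"
      using assms snoc[of w] by (auto simp: b_def aut_pair_def)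
  qed
  moreover have "b i = (if x i then aut_pair id (b (i - 1)) else aut_pair (b (i - 1)) id)"
    if "i \<in> {1..r} - {1, s + 1}" for i
  proof
    fix w show "b i w = (if x i then aut_pair id (b (i - 1)) else aut_pair (b (i - 1)) id) w"
      using that snoc[of w] by (auto simp: b_def aut_pair_def)
  qed
  ultimately have "recursion_relations r s x b"
    unfolding recursion_relations_def by simp
  then show ?thesis by blast
qed

lemma recursion_relations_unique:
  assumes b: "recursion_relations r s x b" and c: "recursion_relations r s x c"
    and sr: "0 < s" "s < r" and i: "i \<in> {1..r}"
  shows "b i = c i"
proof -
  have "b i w = c i w" if "i \<in> {1..r}" for w
    using that
  proof (induction w arbitrary: i rule: rev_induct)
    case Nil
    then show ?case
      using b c by (auto simp: recursion_relations_def W_def tree_auts_def)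
  next
    case (snoc a t)
    consider "i = 1" | "i = s + 1" | "i \<in> {1..r} - {1, s + 1}" using snoc.prems by blast
    then show ?case
    proof cases
      case 1
      then show ?thesis using b c by (simp add: recursion_relations_def)
    next
      case 2
      have gen: "b' i = (if x i then aut_pair (b' s) (b' r) else aut_pair (b' r) (b' s))"
        if "recursion_relations r s x b'" for b'
        using that 2 unfolding recursion_relations_def by metis
      have "b r t = c r t" "b s t = c s t"
        using snoc.IH sr by auto
      then show ?thesis
        unfolding gen[OF b] gen[OF c] by (simp add: aut_pair_def)
    next
      case 3
      have gen: "b' i = (if x i then aut_pair id (b' (i - 1)) else aut_pair (b' (i - 1)) id)"
        if "recursion_relations r s x b'" for b'
        using that 3 unfolding recursion_relations_def by metis
      have "i - 1 \<in> {1..r}"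
        using 3 by auto
      then have "b (i - 1) t = c (i - 1) t"
        by (rule snoc.IH)
      then show ?thesis
        unfolding gen[OF b] gen[OF c] by (simp add: aut_pair_def)
    qed
  qed
  then show ?thesis using i by blast
qed

lemma is_lcd_unique:
  assumes "is_lcd S D" "is_lcd S E"
  shows "D = E"
proof -
  have D0: "coeff D 0 = 1" and E0: "coeff E 0 = 1"
    using assms unfolding is_lcd_def by blast+
  have "{F. D dvd F} = {F. E dvd F}"
    using assms unfolding is_lcd_def by metis
  then have "D dvd E" "E dvd D"
    by (metis dvd_refl mem_Collect_eq)+
  then obtain u v where u: "E = D * u" and v: "D = E * v"
    by (elim dvdE)
  have "D \<noteq> 0"
    using D0 by (metis coeff_0 zero_neq_one)
  moreover have "D * (u * v) = D * 1"
    using u v by (metis mult.assoc mult.right_neutral)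
  ultimately have "u * v = 1"
    by (metis mult_left_cancel)
  then have "u dvd 1"
    by (metis dvd_triv_left)
  then obtain c where c: "u = [:c:]"
    by (metis is_unit_polyE)
  have "coeff E 0 = coeff D 0 * coeff u 0"
    unfolding u by (rule coeff_mult_0)
  then have "c = 1"
    unfolding D0 E0 c by simp
  then show "D = E"
    unfolding u c by simp
qed

lemma lcd_eqI: "is_lcd S D \<Longrightarrow> lcd S = D"
  unfolding lcd_def by (rule the_equality) (auto intro: is_lcd_unique)

end

theory Submission
  imports Defs "HOL-Computational_Algebra.Polynomial_Factorial"
begin

text \<open>
  Put \<open>G\<^sub>w = (1 - 2Y) (\<Phi>\<^sub>w - \<Phi>\<^sub>1) / (X - 2)\<close>, where \<open>\<Phi>\<^sub>1 = 1 / (1 - 2Y)\<close>.  Then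
  \<open>G\<^sub>w = Y (G\<^sub>u + G\<^sub>v)\<close> for \<open>w = (u, v)\<close> and \<open>G\<^sub>w = Y + X Y G\<^sub>u\<^sub>v\<close> for \<open>w = (u, v)\<sigma>\<close>.  For a product \<open>w\<close> of the
  \<open>b\<^sub>i\<close> with \<open>i \<in> J\<close>, each taken once, with \<open>J\<close> satisfying (a) and (b), this is the recursion of \<open>\<Psi>\<^sub>J\<close>, so
  \<open>G\<^sub>w = \<Psi>\<^sub>J\<close>.  Conversely, the number of letters \<open>b\<^sub>i\<close> with \<open>i > s\<close> in a word never grows under the
  recursion, and as soon as it stays constant forever, the word eventually moves in such a way that
  \<open>G\<^sub>w = \<Psi>\<^sub>J\<close> for the set \<open>J\<close> of indices of odd multiplicity.  Hence the denominators of the \<open>G\<^sub>w\<close> are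
  those of the \<open>\<Psi>\<^sub>J\<close>.  As \<open>\<pi>\<close> permutes \<open>{1..s}\<close> and \<open>{s + 1..r}\<close> cyclically, \<open>\<Psi>\<^sub>J\<close> has the denominator
  \<open>1 - (X\<^sup>\<ell> Y\<^sup>s)\<^sup>r\<^sup>-\<^sup>s\<close>, and these are pairwise coprime for different \<open>\<ell>\<close>, and coprime to \<open>X - 2\<close>.
\<close>

section \<open>Orbits on the levels of the tree\<close>

lemma orbit_eq_iterates: "orbit f t = range (\<lambda>n. (f ^^ Suc n) t)"
proof (intro equalityI subsetI)
  fix y assume "y \<in> orbit f t"
  then show "y \<in> range (\<lambda>n. (f ^^ Suc n) t)"
  proof induction
    case base
    then show ?case by (auto intro: image_eqI[of _ _ 0])
  next
    case (step y)
    then obtain n where "y = (f ^^ Suc n) t" by blast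
    then have "f y = (f ^^ Suc (Suc n)) t" by simp
    then show ?case by blast
  qed
next
  have "(f ^^ Suc n) t \<in> orbit f t" for n
    by (induction n) (auto intro: orbit.intros)
  then show "y \<in> orbit f t" if "y \<in> range (\<lambda>n. (f ^^ Suc n) t)" for y
    using that by blast
qed

text \<open>\<open>orbit f t\<close> starts at \<open>f t\<close>, so \<open>t\<close> itself has to
  be found in it: by the pigeonhole principle two iterates agree, and injectivity cancels the
  shorter one.\<close>

lemma self_in_finite_orbit:
  assumes "inj f" "finite (orbit f t)"
  shows "t \<in> orbit f t"
proof -
  have "\<not> inj (\<lambda>n. (f ^^ Suc n) t)"
    using assms(2) unfolding orbit_eq_iterates by (meson finite_imageD infinite_UNIV_nat)
  then obtain m n where mn: "(f ^^ Suc m) t = (f ^^ Suc n) t" "m < n"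
    unfolding inj_def by (metis linorder_neqE_nat)
  have "(f ^^ Suc m) ((f ^^ (n - m)) t) = (f ^^ (Suc m + (n - m))) t"
    unfolding funpow_add by simp
  also have "\<dots> = (f ^^ Suc m) t"
    using mn by (simp del: funpow.simps)
  finally have "(f ^^ (n - m)) t = t"
    using inj_fn[OF assms(1)] unfolding inj_def by blast
  then have "(f ^^ Suc (n - m - 1)) t = t"
    using mn(2) by (simp add: Suc_diff_Suc del: funpow.simps)
  then show ?thesis
    unfolding orbit_eq_iterates by (metis rangeI)
qed

section \<open>Orbits of maps that preserve or exchange the two halves of the tree\<close>

lemma finite_level: "finite {t::vertex. length t = n}"
  using finite_lists_length_eq[of "UNIV :: bool set" n] by simp

lemma orbit_subset_level:
  assumes "\<And>t. length (f t) = length t"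
  shows "orbit f t \<subseteq> {u::vertex. length u = length t}"
proof
  fix u assume "u \<in> orbit f t"
  then show "u \<in> {u. length u = length t}"
    by induction (auto simp: assms)
qed

lemma orbit_count_eq_0:
  assumes "\<And>t. length (f t) = length t" "n < m"
  shows "orbit_count f m n = 0"
proof -
  have "card (orbit f t) < 2 ^ m" if "length t = n" for t
  proof -
    have "card (orbit f t) \<le> card {u::vertex. length u = n}"
      using orbit_subset_level[OF assms(1)] that finite_level by (intro card_mono) auto
    also have "\<dots> = 2 ^ n"
      using card_lists_length_eq[of "UNIV :: bool set" n] by simp
    also have "\<dots> < 2 ^ m" using assms(2) by simp
    finally show ?thesis .
  qed
  then have "{orbit f t |t. length t = n \<and> card (orbit f t) = 2 ^ m} = {}"
    by fastforce
  then show ?thesis unfolding orbit_count_def by (metis card.empty)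
qed

text \<open>Each half is invariant under \<open>w\<close>, so every orbit on the next level is a
  copy \<open>h c\<close> of an orbit of \<open>u c\<close>, and the copies in different halves are
  disjoint.\<close>

lemma orbit_count_fixing:
  assumes w: "\<And>t c. w (t @ [c]) = u c t @ [c]"
  shows "orbit_count w m (Suc n) = orbit_count (u False) m n + orbit_count (u True) m n"
proof -
  define Os where "Os f n = {orbit f t |t. length t = n \<and> card (orbit f t) = 2 ^ m}"
    for f :: "vertex \<Rightarrow> vertex" and n
  define h where "h c = (`) (\<lambda>t. t @ [c])" for c :: bool
  have it: "(w ^^ k) (t @ [c]) = (u c ^^ k) t @ [c]" for k t c
    by (induction k) (auto simp: w)
  have orb: "orbit w (t @ [c]) = h c (orbit (u c) t)" for t c
    unfolding orbit_eq_iterates h_def by (auto simp: it image_iff simp del: funpow.simps)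
  have inj: "inj (h c)" for c
    unfolding h_def by (intro inj_image_eq_iff[THEN iffD1, THEN injI]) (auto simp: inj_def)
  have card: "card (h c A) = card A" for c A
    unfolding h_def by (intro card_image) (auto simp: inj_on_def)
  have "Os w (Suc n) = h False ` Os (u False) n \<union> h True ` Os (u True) n"
  proof (intro equalityI subsetI)
    fix A assume "A \<in> Os w (Suc n)"
    then obtain t' where t': "A = orbit w t'" "length t' = Suc n" "card A = 2 ^ m"
      unfolding Os_def by blast
    then obtain t c where "t' = t @ [c]"
      by (metis length_0_conv nat.distinct(1) rev_exhaust)
    then show "A \<in> h False ` Os (u False) n \<union> h True ` Os (u True) n"
      using t' by (cases c) (auto simp: orb card Os_def)
  next
    fix A assume "A \<in> h False ` Os (u False) n \<union> h True ` Os (u True) n"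
    then obtain c t where "A = h c (orbit (u c) t)" "length t = n" "card (orbit (u c) t) = 2 ^ m"
      unfolding Os_def by blast
    then have "A = orbit w (t @ [c])" "length (t @ [c]) = Suc n" "card (orbit w (t @ [c])) = 2 ^ m"
      by (auto simp: orb card)
    then show "A \<in> Os w (Suc n)" unfolding Os_def by blast
  qed
  moreover have "h False ` Os (u False) n \<inter> h True ` Os (u True) n = {}"
  proof -
    have "h False (orbit f t) \<noteq> h True (orbit g t')" for f g t t'
    proof -
      have "f t @ [False] \<in> h False (orbit f t)"
        unfolding h_def by (intro imageI orbit.base)
      moreover have "f t @ [False] \<notin> h True (orbit g t')"
        unfolding h_def by auto
      ultimately show ?thesis by blast
    qed
    then show ?thesis unfolding Os_def disjoint_iff by auto
  qed
  moreover have "finite (Os f n)" for f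
    unfolding Os_def using finite_level[of n] by (simp add: setcompr_eq_image)
  ultimately have "card (Os w (Suc n)) = card (Os (u False) n) + card (Os (u True) n)"
    by (simp add: card_Un_disjoint card_image inj_on_subset[OF inj])
  then show ?thesis unfolding orbit_count_def Os_def .
qed

text \<open>The square of \<open>w\<close> acts on the half \<open>False\<close> as
  \<open>u True \<circ> u False\<close>. An orbit of \<open>w\<close> is therefore an orbit of this
  composition together with its image under \<open>u False\<close> in the other half, and has twice
  its length.\<close>

lemma orbit_count_swapping:
  assumes w: "\<And>t c. w (t @ [c]) = u c t @ [\<not> c]"
    and len: "\<And>t c. length (u c t) = length t" and inj: "\<And>c. inj (u c)"
    and lenw: "\<And>t. length (w t) = length t" and injw: "inj w"
  shows "orbit_count w 0 (Suc n) = 0"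
    and "orbit_count w (Suc m) (Suc n) = orbit_count (u True \<circ> u False) m n"
proof -
  define v where "v = u True \<circ> u False"
  define h where "h A = (\<lambda>t. t @ [False]) ` A \<union> (\<lambda>t. u False t @ [True]) ` A" for A
  have lenv: "length (v t) = length t" for t
    by (simp add: v_def len)
  have injv: "inj v"
    unfolding v_def using inj by (intro inj_compose) auto
  have self: "t \<in> orbit v t" for t
    by (rule self_in_finite_orbit[OF injv])
       (rule finite_subset[OF orbit_subset_level[OF lenv] finite_level])
  have it2: "(w ^^ (2 * k)) (t @ [False]) = (v ^^ k) t @ [False]" for k t
    by (induction k) (auto simp: w v_def)
  have it1: "(w ^^ Suc (2 * k)) (t @ [False]) = u False ((v ^^ k) t) @ [True]" for k t
    using it2[of k t] by (simp add: w)
  have orb: "orbit w (t @ [False]) = h (orbit v t)" for t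
  proof (intro equalityI subsetI)
    fix y assume "y \<in> orbit w (t @ [False])"
    then obtain k where y: "y = (w ^^ Suc k) (t @ [False])"
      unfolding orbit_eq_iterates by blast
    show "y \<in> h (orbit v t)"
    proof (cases "even k")
      case True
      then obtain j where "k = 2 * j" by blast
      then have "y = u False ((v ^^ j) t) @ [True]" using y it1 by blast
      moreover have "(v ^^ j) t \<in> orbit v t"
        using self[of t] by (induction j) (auto intro: orbit.step)
      ultimately show ?thesis unfolding h_def by blast
    next
      case False
      then obtain j where "k = 2 * j + 1" by (elim oddE)
      then have "y = (v ^^ Suc j) t @ [False]"
        using y it2[of "Suc j"] by simp
      then show ?thesis unfolding h_def orbit_eq_iterates by blast
    qed
  next
    fix y assume "y \<in> h (orbit v t)"
    then consider k where "y = (v ^^ Suc k) t @ [False]"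
      | k where "y = u False ((v ^^ Suc k) t) @ [True]"
      unfolding h_def orbit_eq_iterates by blast
    then show "y \<in> orbit w (t @ [False])"
    proof cases
      case 1
      then have "y = (w ^^ Suc (2 * k + 1)) (t @ [False])"
        using it2[of "Suc k" t] by simp
      then show ?thesis unfolding orbit_eq_iterates by blast
    next
      case 2
      then have "y = (w ^^ Suc (2 * Suc k)) (t @ [False])"
        using it1[of "Suc k" t] by simp
      then show ?thesis unfolding orbit_eq_iterates by blast
    qed
  qed
  have orbT: "orbit w (t @ [True]) = h (orbit v (u True t))" for t
  proof -
    have "t @ [True] \<in> orbit w (t @ [True])"
      by (rule self_in_finite_orbit[OF injw])
         (rule finite_subset[OF orbit_subset_level[OF lenw] finite_level])
    \<comment> \<open>An orbit does not change when its base point moves one step, and that step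
      leads into the half \<open>False\<close>, where \<open>orb\<close> applies.\<close>
    then have "orbit w (t @ [True]) = orbit w (w (t @ [True]))"
      by (metis orbit.base orbit_swap orbit_trans subsetI subset_antisym)
    then show ?thesis using orb[of "u True t"] by (simp add: w)
  qed
  have fin: "finite (orbit v t)" for t
    by (rule finite_subset[OF orbit_subset_level[OF lenv] finite_level])
  have card: "card (h A) = 2 * card A" if "finite A" for A
  proof -
    have "card (h A) = card ((\<lambda>t. t @ [False]) ` A) + card ((\<lambda>t. u False t @ [True]) ` A)"
      unfolding h_def using that by (intro card_Un_disjoint) auto
    also have "\<dots> = card A + card A"
      using inj[of False] by (intro arg_cong2[where f = "(+)"] card_image) (auto simp: inj_on_def inj_def)
    finally show ?thesis by simp
  qed
  have injh: "inj h"
  proof (rule injI)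
    fix A B assume "h A = h B"
    moreover have "A = {t. t @ [False] \<in> h A}" for A unfolding h_def by auto
    ultimately show "A = B" by metis
  qed
  have orbits: "\<exists>t. length t = n \<and> orbit w t' = h (orbit v t)" if t': "length t' = Suc n" for t'
  proof -
    obtain t c where tc: "t' = t @ [c]" "length t = n"
      using t' by (cases t' rule: rev_cases) auto
    then show ?thesis
      using orb[of t] orbT[of t] len[of True t] by (cases c) (auto intro: exI[of _ t] exI[of _ "u True t"])
  qed
  show "orbit_count w 0 (Suc n) = 0"
  proof -
    have "card (orbit w t') \<noteq> 2 ^ 0" if "length t' = Suc n" for t'
      using orbits[OF that] card[OF fin] by auto
    then have "{orbit w t |t. length t = Suc n \<and> card (orbit w t) = 2 ^ 0} = {}" by blast
    then show ?thesis unfolding orbit_count_def by (metis card.empty)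
  qed
  have "{orbit w t |t. length t = Suc n \<and> card (orbit w t) = 2 ^ Suc m} =
    h ` {orbit v t |t. length t = n \<and> card (orbit v t) = 2 ^ m}"
  proof (intro equalityI subsetI)
    fix A assume "A \<in> {orbit w t |t. length t = Suc n \<and> card (orbit w t) = 2 ^ Suc m}"
    then obtain t' where "A = orbit w t'" "length t' = Suc n" "card A = 2 ^ Suc m" by blast
    then obtain t where "length t = n" "A = h (orbit v t)" "card A = 2 ^ Suc m"
      using orbits by blast
    then show "A \<in> h ` {orbit v t |t. length t = n \<and> card (orbit v t) = 2 ^ m}"
      using card[OF fin] by auto
  next
    fix A assume "A \<in> h ` {orbit v t |t. length t = n \<and> card (orbit v t) = 2 ^ m}"
    then obtain t where "length t = n" "A = h (orbit v t)" "card (orbit v t) = 2 ^ m" by blast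
    then have "A = orbit w (t @ [False])" "length (t @ [False]) = Suc n" "card A = 2 ^ Suc m"
      using orb card[OF fin] by auto
    then show "A \<in> {orbit w t |t. length t = Suc n \<and> card (orbit w t) = 2 ^ Suc m}" by blast
  qed
  then show "orbit_count w (Suc m) (Suc n) = orbit_count (u True \<circ> u False) m n"
    unfolding orbit_count_def v_def[symmetric] by (simp add: card_image inj_on_subset[OF injh])
qed

section \<open>Generating functions and rational series\<close>

abbreviation PX :: "int poly poly" where
  "PX \<equiv> [:[:0, 1:]:]"

abbreviation SX :: "int fps fps" where
  "SX \<equiv> fps_const fps_X"

abbreviation SY :: "int fps fps" where
  "SY \<equiv> fps_X"

lemma orbit_count_root:
  assumes "w [] = []"
  shows "orbit_count w m 0 = (if m = 0 then 1 else 0)"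
proof -
  have "y = []" if "y \<in> orbit w []" for y
    using that by induction (auto simp: assms)
  moreover have "[] \<in> orbit w []"
    by (metis assms orbit.base)
  ultimately have "orbit w [] = {[]}" by blast
  moreover have one: "Suc 0 = 2 ^ m \<longleftrightarrow> m = 0"
    by (cases m) auto
  ultimately have "{orbit w t |t. length t = 0 \<and> card (orbit w t) = 2 ^ m} = {A. A = {[]} \<and> m = 0}"
    using one by simp
  then have "orbit_count w m 0 = card {A. A = {[]::vertex} \<and> m = 0}"
    unfolding orbit_count_def by (rule arg_cong)
  then show ?thesis by (cases m) simp_all
qed

lemma Phi_nth:
  assumes "\<And>t. length (w t) = length t"
  shows "fps_nth (fps_nth (Phi w) n) m = int (orbit_count w m n)"
proof (cases "m \<le> n")
  case False
  then have "orbit_count w m n = 0"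
    by (intro orbit_count_eq_0 assms) simp
  then show ?thesis using False by (simp add: Phi_def)
qed (simp add: Phi_def)

lemma Phi_nth_0:
  assumes "\<And>t. length (w t) = length t"
  shows "fps_nth (Phi w) 0 = 1"
proof -
  have "w [] = []" using assms[of "[]"] by simp
  then show ?thesis
    by (intro fps_ext) (simp add: Phi_nth assms orbit_count_root)
qed

lemma Phi_fixing:
  assumes w: "\<And>t c. w (t @ [c]) = u c t @ [c]"
    and len: "\<And>t c. length (u c t) = length t" "\<And>t. length (w t) = length t"
  shows "Phi w = 1 + SY * (Phi (u False) + Phi (u True))"
proof (rule fps_ext)
  fix n
  show "fps_nth (Phi w) n = fps_nth (1 + SY * (Phi (u False) + Phi (u True))) n"
  proof (cases n)
    case 0
    then show ?thesis by (simp add: Phi_nth_0 len)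
  next
    case (Suc k)
    have "fps_nth (Phi w) (Suc k) = fps_nth (Phi (u False)) k + fps_nth (Phi (u True)) k"
      by (rule fps_ext) (simp add: Phi_nth len orbit_count_fixing[of w u, OF w])
    then show ?thesis using Suc by simp
  qed
qed

lemma Phi_swapping:
  assumes w: "\<And>t c. w (t @ [c]) = u c t @ [\<not> c]"
    and len: "\<And>t c. length (u c t) = length t" "\<And>t. length (w t) = length t"
    and inj: "\<And>c. inj (u c)" "inj w"
  shows "Phi w = 1 + SX * SY * Phi (u True \<circ> u False)"
proof (rule fps_ext)
  fix n
  show "fps_nth (Phi w) n = fps_nth (1 + SX * SY * Phi (u True \<circ> u False)) n"
  proof (cases n)
    case 0
    then show ?thesis by (simp add: Phi_nth_0 len fps_mult_nth_0)
  next
    case (Suc k)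
    have "fps_nth (Phi w) (Suc k) = fps_X * fps_nth (Phi (u True \<circ> u False)) k"
    proof (rule fps_ext)
      fix m
      show "fps_nth (fps_nth (Phi w) (Suc k)) m = fps_nth (fps_X * fps_nth (Phi (u True \<circ> u False)) k) m"
        by (cases m) (simp_all add: Phi_nth len orbit_count_swapping[of w u, OF w len(1) inj(1) len(2) inj(2)])
    qed
    then show ?thesis using Suc by (simp add: mult.assoc)
  qed
qed

section \<open>Integer polynomials in two variables as a subring of the power series\<close>

lemma series_of_poly_nth: "fps_nth (series_of_poly p) n = fps_of_poly (coeff p n)"
  by (simp add: series_of_poly_def coeff_map_poly)

lemma series_of_poly_eq_iff [simp]: "series_of_poly p = series_of_poly q \<longleftrightarrow> p = q"
  by (auto simp: fps_eq_iff[of "series_of_poly p"] series_of_poly_nth fps_of_poly_eq_iff poly_eq_iff[of p])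

lemma series_of_poly_0 [simp]: "series_of_poly 0 = 0"
  by (rule fps_ext) (simp add: series_of_poly_nth)

lemma series_of_poly_1 [simp]: "series_of_poly 1 = 1"
  by (rule fps_ext) (auto simp: series_of_poly_nth)

lemma series_of_poly_add [simp]: "series_of_poly (p + q) = series_of_poly p + series_of_poly q"
  by (rule fps_ext) (simp add: series_of_poly_nth fps_of_poly_add)

lemma series_of_poly_diff [simp]: "series_of_poly (p - q) = series_of_poly p - series_of_poly q"
  by (rule fps_ext) (simp add: series_of_poly_nth fps_of_poly_diff)

lemma series_of_poly_mult [simp]: "series_of_poly (p * q) = series_of_poly p * series_of_poly q"
  by (rule fps_ext)
     (simp add: series_of_poly_nth fps_mult_nth coeff_mult fps_of_poly_sum fps_of_poly_mult atLeast0AtMost)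

lemma series_of_poly_power [simp]: "series_of_poly (p ^ n) = series_of_poly p ^ n"
  by (induction n) simp_all

lemma series_of_poly_numeral [simp]: "series_of_poly (numeral n) = numeral n"
  by (rule fps_ext)
     (auto simp: series_of_poly_nth numeral_poly numeral_fps_const coeff_pCons split: nat.split)

lemma series_of_poly_PX [simp]: "series_of_poly PX = SX"
  by (rule fps_ext) (auto simp: series_of_poly_nth coeff_pCons split: nat.split)

lemma series_of_poly_PY [simp]: "series_of_poly PY = SY"
  by (rule fps_ext) (auto simp: series_of_poly_nth coeff_pCons split: nat.split)

lemma range_series_of_poly_closed [simp, intro]:
  shows zero_in_range_series_of_poly: "0 \<in> range series_of_poly"
    and one_in_range_series_of_poly: "1 \<in> range series_of_poly"
    and numeral_in_range_series_of_poly: "numeral k \<in> range series_of_poly"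
    and SX_in_range_series_of_poly: "SX \<in> range series_of_poly"
    and SY_in_range_series_of_poly: "SY \<in> range series_of_poly"
  using rangeI[of series_of_poly 0] rangeI[of series_of_poly 1] rangeI[of series_of_poly "numeral k"]
    rangeI[of series_of_poly PX] rangeI[of series_of_poly PY]
  by (simp_all only: series_of_poly_0 series_of_poly_1 series_of_poly_numeral series_of_poly_PX
      series_of_poly_PY)

lemma range_series_of_poly_add [intro]:
  assumes "f \<in> range series_of_poly" "g \<in> range series_of_poly"
  shows "f + g \<in> range series_of_poly"
proof -
  obtain p q where "f = series_of_poly p" "g = series_of_poly q"
    using assms by (elim imageE)
  then have "f + g = series_of_poly (p + q)" by simp
  then show ?thesis by (rule range_eqI)
qed

lemma range_series_of_poly_diff [intro]:
  assumes "f \<in> range series_of_poly" "g \<in> range series_of_poly"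
  shows "f - g \<in> range series_of_poly"
proof -
  obtain p q where "f = series_of_poly p" "g = series_of_poly q"
    using assms by (elim imageE)
  then have "f - g = series_of_poly (p - q)" by simp
  then show ?thesis by (rule range_eqI)
qed

lemma range_series_of_poly_mult [intro]:
  assumes "f \<in> range series_of_poly" "g \<in> range series_of_poly"
  shows "f * g \<in> range series_of_poly"
proof -
  obtain p q where "f = series_of_poly p" "g = series_of_poly q"
    using assms by (elim imageE)
  then have "f * g = series_of_poly (p * q)" by simp
  then show ?thesis by (rule range_eqI)
qed

lemma range_series_of_poly_power [intro]:
  assumes "f \<in> range series_of_poly"
  shows "f ^ n \<in> range series_of_poly"
proof -
  obtain p where "f = series_of_poly p"
    using assms by (elim imageE)
  then have "f ^ n = series_of_poly (p ^ n)" by simp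
  then show ?thesis by (rule range_eqI)
qed

section \<open>Existence and normalization of lowest common denominators\<close>

lemma is_unit_coeff_0_of_dvd:
  fixes d E :: "int poly poly"
  assumes "d dvd E" "coeff E 0 = 1"
  shows "coeff d 0 dvd 1"
proof -
  obtain k where "E = d * k" using assms(1) by (elim dvdE)
  then have "1 = coeff d 0 * coeff k 0" using assms(2) by (simp add: coeff_mult_0)
  then show ?thesis by (rule dvdI)
qed

text \<open>A common divisor is free of \<open>Y\<close> because it divides \<open>[:c:]\<close>,
  and its constant coefficient is a unit because it divides \<open>D\<close>.\<close>

lemma coprime_const_poly:
  fixes D :: "int poly poly"
  assumes "coeff D 0 = 1" "c \<noteq> 0"
  shows "coprime [:c:] D"
proof (rule coprimeI)
  fix d assume d: "d dvd [:c:]" "d dvd D"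
  have "degree d = 0"
    using dvd_imp_degree_le[OF d(1)] assms(2) by simp
  then obtain e where "d = [:e:]" by (metis degree_0_id)
  then show "d dvd 1"
    using is_unit_coeff_0_of_dvd[OF d(2) assms(1)] by (simp add: is_unit_const_poly_iff)
qed

lemma normalize_coeff_0:
  fixes d E :: "int poly poly"
  assumes "d dvd E" "coeff E 0 = 1"
  obtains d' where "coeff d' 0 = 1" "\<And>F. d' dvd F \<longleftrightarrow> d dvd F"
proof -
  obtain k where k: "k * coeff d 0 = 1"
    using is_unit_coeff_0_of_dvd[OF assms] by (metis dvdE mult.commute)
  then have "[:k:] dvd 1"
    by (simp add: is_unit_const_poly_iff) (metis dvd_triv_left)
  then have "[:k:] * d dvd F \<longleftrightarrow> d dvd F" for F
    using mult_unit_dvd_iff' by blast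
  moreover have "coeff ([:k:] * d) 0 = 1"
    using k by simp
  ultimately show ?thesis using that by blast
qed

text \<open>Cancelling the gcd writes \<open>f\<close> as \<open>n / a\<close> in lowest terms. Then
  \<open>D * f\<close> is a polynomial iff \<open>a\<close> divides \<open>D * n\<close>, that is,
  iff \<open>a\<close> divides \<open>D\<close>.\<close>

lemma ex_is_lcd_singleton:
  assumes E: "coeff E 0 = 1" "series_of_poly E * f \<in> range series_of_poly"
  obtains D where "is_lcd {f} D" 
proof -
  obtain N where N: "series_of_poly E * f = series_of_poly N"
    using E(2) by blast
  have E0: "E \<noteq> 0" using E(1) by auto
  then obtain a n where a: "E = a * gcd E N" "N = n * gcd E N" "coprime a n"
    using gcd_coprime_exists[of E N] by (metis gcd_eq_0_iff)
  have g0: "gcd E N \<noteq> 0" using E0 by simp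
  have iff: "series_of_poly D * f \<in> range series_of_poly \<longleftrightarrow> a dvd D" for D
  proof -
    have "series_of_poly D * f = series_of_poly M \<longleftrightarrow> D * N = E * M" for M
    proof -
      have "series_of_poly D * f = series_of_poly M \<longleftrightarrow>
        series_of_poly E * (series_of_poly D * f) = series_of_poly E * series_of_poly M"
        using E0 series_of_poly_eq_iff[of E 0] by (simp del: series_of_poly_eq_iff)
      also have "series_of_poly E * (series_of_poly D * f) = series_of_poly (D * N)"
        using N by (simp add: mult.left_commute)
      finally show ?thesis
        by (metis series_of_poly_eq_iff series_of_poly_mult)
    qed
    then have "series_of_poly D * f \<in> range series_of_poly \<longleftrightarrow> E dvd D * N"
      by (auto simp: dvd_def image_iff)
    also have "\<dots> \<longleftrightarrow> a * gcd E N dvd (D * n) * gcd E N"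
      using a(1,2) by (metis mult.assoc)
    also have "\<dots> \<longleftrightarrow> a dvd D * n"
      using g0 dvd_times_right_cancel_iff by blast
    also have "\<dots> \<longleftrightarrow> a dvd D"
      using a(3) by (simp add: coprime_dvd_mult_left_iff)
    finally show ?thesis .
  qed
  have "a dvd E" using a(1) by (metis dvd_triv_left)
  then obtain a' where "coeff a' 0 = 1" "\<And>F. a' dvd F \<longleftrightarrow> a dvd F"
    using normalize_coeff_0 E(1) by blast
  then have "is_lcd {f} a'"
    unfolding is_lcd_def denominator_ideal_def using iff by auto
  then show ?thesis using that by blast
qed

text \<open>The denominator ideal of a union is the intersection of the ideals, and principal ideals
  intersect in the ideal of the lcm. The lcm can be normalized because it divides
  \<open>a * D\<close>, whose constant coefficient is 1.\<close>

lemma ex_is_lcd: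
  assumes "finite S"
    and "\<And>f. f \<in> S \<Longrightarrow> \<exists>E. coeff E 0 = 1 \<and> series_of_poly E * f \<in> range series_of_poly"
  shows "\<exists>D. is_lcd S D"
  using assms
proof (induction S rule: finite_induct)
  case empty
  then show ?case
    by (auto simp: is_lcd_def denominator_ideal_def intro!: exI[of _ 1])
next
  case (insert f S)
  obtain D where D: "is_lcd S D" using insert by blast
  obtain a where a: "is_lcd {f} a"
    using insert.prems ex_is_lcd_singleton by blast
  have "coeff (a * D) 0 = 1"
    using D a unfolding is_lcd_def by (metis coeff_mult_0 mult_1)
  moreover have "lcm a D dvd a * D"
    by (rule lcm_least) auto
  ultimately obtain m where m: "coeff m 0 = 1" "\<And>F. m dvd F \<longleftrightarrow> lcm a D dvd F"
    using normalize_coeff_0 by metis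
  have "denominator_ideal (insert f S) = denominator_ideal {f} \<inter> denominator_ideal S"
    unfolding denominator_ideal_def by auto
  also have "\<dots> = {E. m dvd E}"
    using D a m(2) unfolding is_lcd_def by auto
  finally show ?case
    unfolding is_lcd_def using m(1) by blast
qed

section \<open>Words in the generators\<close>

declare One_nat_def [simp del]

locale kneading =
  fixes r s :: nat and x :: "nat \<Rightarrow> bool" and b :: "nat \<Rightarrow> vertex \<Rightarrow> vertex"
  assumes s_pos: "0 < s" and s_less: "s < r" and rec: "recursion_relations r s x b"
begin

text \<open>
  The word \<open>letter i c\<close> represents the action of \<open>b i\<close> below the vertex \<open>c\<close> of the first level, and
  \<open>sec c L\<close> that of the word \<open>L\<close>.
\<close>

definition letter :: "nat \<Rightarrow> bool \<Rightarrow> nat list" where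
  "letter i c =
     (if i = 1 then []
      else if i = s + 1 then [if c = x i then r else s]
      else if c = x i then [i - 1] else [])"

primrec ev :: "nat list \<Rightarrow> vertex \<Rightarrow> vertex" where
  "ev [] = id"
| "ev (i # L) = b i \<circ> ev L"

text \<open>Only \<open>b 1\<close> exchanges the two halves, so this parity is the action of
  \<open>ev L\<close> on the first level. In \<open>sec\<close> it tells to which vertex
  \<open>L\<close> has moved \<open>c\<close> before the next letter acts.\<close>

definition sigma_odd :: "nat list \<Rightarrow> bool" where
  "sigma_odd L \<longleftrightarrow> odd (count_list L 1)"

primrec sec :: "bool \<Rightarrow> nat list \<Rightarrow> nat list" where
  "sec c [] = []"
| "sec c (i # L) = letter i (c \<noteq> sigma_odd L) @ sec c L"

section \<open>The self-similar action of words, and the group as the set of their values\<close>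

lemma sigma_odd_simps [simp]:
  "\<not> sigma_odd []" "sigma_odd (i # L) \<longleftrightarrow> (sigma_odd L \<noteq> (i = 1))"
  by (auto simp: sigma_odd_def)

lemma sigma_odd_append [simp]: "sigma_odd (K @ L) \<longleftrightarrow> sigma_odd K \<noteq> sigma_odd L"
  by (simp add: sigma_odd_def)

lemma ev_append: "ev (K @ L) = ev K \<circ> ev L"
  by (induction K) (simp_all add: comp_assoc)

lemma b_snoc:
  assumes "i \<in> {1..r}"
  shows "b i (t @ [c]) = ev (letter i c) t @ [c \<noteq> (i = 1)]"
proof -
  consider "i = 1" | "i = s + 1" | "i \<in> {1..r} - {1, s + 1}" using assms by blast
  then show ?thesis
  proof cases
    case 1
    then show ?thesis using rec by (simp add: recursion_relations_def letter_def swap_def)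
  next
    case 2
    have "b i = (if x i then aut_pair (b s) (b r) else aut_pair (b r) (b s))"
      using rec 2 unfolding recursion_relations_def by metis
    then show ?thesis using 2 s_pos by (auto simp: aut_pair_def letter_def)
  next
    case 3
    have "b i = (if x i then aut_pair id (b (i - 1)) else aut_pair (b (i - 1)) id)"
      using rec 3 unfolding recursion_relations_def by metis
    then show ?thesis using 3 by (auto simp: aut_pair_def letter_def)
  qed
qed

lemma b_Nil: "i \<in> {1..r} \<Longrightarrow> b i [] = []"
  using rec by (auto simp: recursion_relations_def W_def tree_auts_def)

lemma set_letter: "i \<in> {1..r} \<Longrightarrow> set (letter i c) \<subseteq> {1..r}"
  using s_pos s_less by (auto simp: letter_def)

lemma set_sec: "set L \<subseteq> {1..r} \<Longrightarrow> set (sec c L) \<subseteq> {1..r}"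
proof (induction L)
  case (Cons i L)
  then show ?case using set_letter[of i "c \<noteq> sigma_odd L"] by simp
qed simp

lemma ev_snoc:
  "set L \<subseteq> {1..r} \<Longrightarrow> ev L (t @ [c]) = ev (sec c L) t @ [c \<noteq> sigma_odd L]"
  by (induction L) (auto simp: b_snoc ev_append)

lemma ev_Nil: "set L \<subseteq> {1..r} \<Longrightarrow> ev L [] = []"
  by (induction L) (auto simp: b_Nil)

lemma length_ev: "set L \<subseteq> {1..r} \<Longrightarrow> length (ev L t) = length t"
proof (induction t arbitrary: L rule: rev_induct)
  case (snoc c t)
  then show ?case using set_sec by (simp add: ev_snoc)
qed (simp add: ev_Nil)

text \<open>A generator meets the same letter at \<open>c\<close> and at the image of
  \<open>c\<close>: \<open>b 1\<close> has no letters below, and all others fix \<open>c\<close>.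
  Induction on the level does the rest.\<close>

lemma b_involution: "i \<in> {1..r} \<Longrightarrow> b i (b i t) = t"
proof (induction t arbitrary: i rule: rev_induct)
  case Nil
  then show ?case by (simp add: b_Nil)
next
  case (snoc c t)
  have "letter i (c \<noteq> (i = 1)) = letter i c"
    by (simp add: letter_def)
  moreover have "letter i c = [] \<or> (\<exists>j\<in>{1..r}. letter i c = [j])"
    using s_pos s_less snoc.prems by (auto simp: letter_def)
  ultimately show ?case
    using snoc by (auto simp: b_snoc)
qed

lemma inj_ev: "set L \<subseteq> {1..r} \<Longrightarrow> inj (ev L)"
proof (induction L)
  case (Cons i L)
  then have "inj (b i)"
    by (metis b_involution injI list.set_intros(1) subsetD)
  then show ?case
    using Cons unfolding ev.simps by (intro inj_compose) auto
qed auto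

text \<open>The generators are their own inverses, so words without inverse letters exhaust the
  group.\<close>

lemma Gam_eq: "Gam r b = ev ` {L. set L \<subseteq> {1..r}}"
proof (intro equalityI subsetI)
  fix w assume "w \<in> Gam r b"
  then show "w \<in> ev ` {L. set L \<subseteq> {1..r}}"
    unfolding Gam_def
  proof induction
    case one
    then show ?case
      by (intro image_eqI[of _ _ "[]"]) (auto simp: W_def)
  next
    case (incl h)
    then obtain i where "h = b i" "i \<in> {1..r}" by blast
    then show ?case by (intro image_eqI[of _ _ "[i]"]) auto
  next
    case (inv h)
    then obtain i where i: "h = b i" "i \<in> {1..r}" by blast
    then have "b i \<in> carrier W" "b i \<otimes>\<^bsub>W\<^esub> b i = \<one>\<^bsub>W\<^esub>"
      using rec by (auto simp: recursion_relations_def W_def fun_eq_iff b_involution)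
    then have "inv\<^bsub>W\<^esub> (b i) = b i"
      by (metis group.inv_equality group_W)
    then show ?case using i by (intro image_eqI[of _ _ "[i]"]) auto
  next
    case (eng h1 h2)
    then obtain K L where "h1 = ev K" "h2 = ev L" "set K \<subseteq> {1..r}" "set L \<subseteq> {1..r}" by blast
    then show ?case
      by (intro image_eqI[of _ _ "K @ L"]) (auto simp: W_def ev_append)
  qed
next
  fix w assume "w \<in> ev ` {L. set L \<subseteq> {1..r}}"
  then obtain L where "w = ev L" "set L \<subseteq> {1..r}" by blast
  moreover have "ev L \<in> generate W (b ` {1..r})" if "set L \<subseteq> {1..r}"
    using that
  proof (induction L)
    case Nil
    have "\<one>\<^bsub>W\<^esub> = ev []" by (simp add: W_def)
    then show ?case using generate.one[of W] by metis
  next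
    case (Cons i L)
    then have "b i \<in> generate W (b ` {1..r})" "ev L \<in> generate W (b ` {1..r})"
      by (auto intro: generate.incl)
    then have "b i \<otimes>\<^bsub>W\<^esub> ev L \<in> generate W (b ` {1..r})"
      by (rule generate.eng)
    moreover have "b i \<otimes>\<^bsub>W\<^esub> ev L = ev (i # L)" by (simp add: W_def)
    ultimately show ?case by metis
  qed
  ultimately show "w \<in> Gam r b" unfolding Gam_def by blast
qed

text \<open>Says that \<open>g\<close> is the quotient \<open>G\<^sub>w\<close> for \<open>w = ev L\<close>, without dividing by \<open>X - 2\<close>.\<close>

definition reduced :: "nat list \<Rightarrow> int fps fps \<Rightarrow> bool" where
  "reduced L g \<longleftrightarrow> (1 - 2 * SY) * Phi (ev L) = 1 + (SX - 2) * g"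

section \<open>The recursion of the quotients \<open>G\<^sub>w\<close>\<close>

lemma Phi_ev_even:
  assumes "set L \<subseteq> {1..r}" "\<not> sigma_odd L"
  shows "Phi (ev L) = 1 + SY * (Phi (ev (sec c L)) + Phi (ev (sec (\<not> c) L)))"
proof -
  have "Phi (ev L) = 1 + SY * (Phi (ev (sec False L)) + Phi (ev (sec True L)))"
    by (rule Phi_fixing[where u = "\<lambda>c. ev (sec c L)"]) (simp_all add: assms ev_snoc length_ev set_sec)
  then show ?thesis by (cases c) (simp_all add: add.commute)
qed

lemma Phi_ev_odd:
  assumes "set L \<subseteq> {1..r}" "sigma_odd L"
  shows "Phi (ev L) = 1 + SX * SY * Phi (ev (sec True L @ sec False L))"
  unfolding ev_append
  by (rule Phi_swapping[where u = "\<lambda>c. ev (sec c L)"]) (simp_all add: assms ev_snoc length_ev set_sec inj_ev)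

lemma reduced_even:
  assumes "set L \<subseteq> {1..r}" "\<not> sigma_odd L" "reduced (sec c L) g" "reduced (sec (\<not> c) L) h"
  shows "reduced L (SY * (g + h))"
proof -
  have "(1 - 2 * SY) * Phi (ev L) = (1 - 2 * SY)
      + SY * ((1 - 2 * SY) * Phi (ev (sec c L)) + (1 - 2 * SY) * Phi (ev (sec (\<not> c) L)))"
    unfolding Phi_ev_even[OF assms(1,2), of c] by (simp add: algebra_simps)
  also have "\<dots> = 1 + (SX - 2) * (SY * (g + h))"
    unfolding assms(3,4)[unfolded reduced_def] by (simp add: algebra_simps)
  finally show ?thesis unfolding reduced_def .
qed

text \<open>The summand \<open>SY\<close> of the quotient comes from
  \<open>1 - 2 * SY + SX * SY = 1 + (SX - 2) * SY\<close>.\<close>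

lemma reduced_odd:
  assumes "set L \<subseteq> {1..r}" "sigma_odd L" "reduced (sec True L @ sec False L) g"
  shows "reduced L (SY + SX * SY * g)"
proof -
  have "(1 - 2 * SY) * Phi (ev L) = (1 - 2 * SY)
      + SX * SY * ((1 - 2 * SY) * Phi (ev (sec True L @ sec False L)))"
    unfolding Phi_ev_odd[OF assms(1,2)] by (simp add: algebra_simps)
  also have "\<dots> = 1 + (SX - 2) * (SY + SX * SY * g)"
    unfolding assms(3)[unfolded reduced_def] by (simp add: algebra_simps del: fps_const_mult)
  finally show ?thesis unfolding reduced_def .
qed

lemma Phi_id: "(1 - 2 * SY) * Phi id = 1"
  using Phi_ev_even[of "[]" True] by (simp add: algebra_simps)

lemma reduced_Nil: "reduced [] 0"
  unfolding reduced_def using Phi_id by simp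

end

section \<open>The series of a subset and of a word\<close>

lemma perm_pow_Suc: "perm_pow r s (Suc n) J = perm_pow r s n (perm r s ` J)"
  by (simp add: funpow_Suc_right image_comp del: funpow.simps)

lemma ell_0 [simp]: "ell r s J 0 = 0"
  by (simp add: ell_def)

lemma ell_Suc: "ell r s J (Suc m) = (if 1 \<in> J then 1 else 0) + ell r s (perm r s ` J) m"
proof -
  have "{i. i < Suc m \<and> 1 \<in> perm_pow r s i J} =
      (if 1 \<in> J then {0} else {}) \<union> Suc ` {i. i < m \<and> 1 \<in> perm_pow r s i (perm r s ` J)}"
    (is "?A = ?B \<union> Suc ` ?C")
  proof (intro Set.set_eqI)
    fix i show "i \<in> ?A \<longleftrightarrow> i \<in> ?B \<union> Suc ` ?C"
      by (cases i) (auto simp: perm_pow_Suc simp del: funpow.simps)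
  qed
  moreover have "card (?B \<union> Suc ` ?C) = card ?B + card (Suc ` ?C)"
    by (intro card_Un_disjoint) auto
  ultimately show ?thesis
    unfolding ell_def by (simp add: card_image)
qed

lemma ell_add: "ell r s J (m + n) = ell r s J m + ell r s (perm_pow r s m J) n"
  by (induction m arbitrary: J) (simp_all add: ell_Suc perm_pow_Suc del: funpow.simps)

text \<open>The coefficient of \<open>Y ^ n\<close> in either sum of \<Psi>, where only
  \<open>m = n - (k + 1)\<close> contributes; \<open>k = 0\<close> belongs to the first sum and
  \<open>k = s\<close> to the second.\<close>

definition psi_term :: "nat \<Rightarrow> nat \<Rightarrow> nat \<Rightarrow> (nat set \<Rightarrow> bool) \<Rightarrow> nat set \<Rightarrow> nat \<Rightarrow> int fps" where
  "psi_term r s k P J n =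
     (if k < n \<and> P (perm_pow r s (n - Suc k) J) then fps_X ^ ell r s J (n - Suc k) else 0)"

lemma psi_term_Suc:
  "psi_term r s k P J (Suc n) =
     (if n = k \<and> P J then 1 else 0) + (if 1 \<in> J then fps_X else 1) * psi_term r s k P (perm r s ` J) n"
proof -
  consider "n < k" | "n = k" | d where "n = Suc (k + d)"
    by (metis less_imp_Suc_add linorder_neqE_nat)
  then show ?thesis
    by cases (auto simp: psi_term_def ell_Suc perm_pow_Suc One_nat_def simp del: funpow.simps)
qed

lemma sum_single_index:
  fixes f :: "nat \<Rightarrow> 'a :: comm_monoid_add"
  shows "(\<Sum>m | m < n \<and> n = m + k + 1 \<and> P m. f m) =
    (if k < n \<and> P (n - Suc k) then f (n - Suc k) else 0)"
proof -
  have "{m. m < n \<and> n = m + k + 1 \<and> P m} = (if k < n \<and> P (n - Suc k) then {n - Suc k} else {})"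
    by auto
  then show ?thesis by simp
qed

lemma Psi_nth:
  "fps_nth (Psi r s J) n =
     psi_term r s 0 (\<lambda>K. 1 \<in> K) J n + psi_term r s s (\<lambda>K. 1 \<notin> K \<and> s + 1 \<in> K) J n"
proof -
  have "(\<Sum>m | m < n \<and> n = m + 1 \<and> 1 \<in> perm_pow r s m J. fps_X ^ ell r s J m)
      = psi_term r s 0 (\<lambda>K. 1 \<in> K) J n"
    using sum_single_index[where n = n and k = 0 and P = "\<lambda>m. 1 \<in> perm_pow r s m J"
      and f = "\<lambda>m. fps_X ^ ell r s J m"] by (simp add: psi_term_def)
  moreover have "(\<Sum>m | m < n \<and> n = m + s + 1 \<and> 1 \<notin> perm_pow r s m J \<and> s + 1 \<in> perm_pow r s m J.
      fps_X ^ ell r s J m) = psi_term r s s (\<lambda>K. 1 \<notin> K \<and> s + 1 \<in> K) J n"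
    using sum_single_index[where n = n and k = s
      and P = "\<lambda>m. 1 \<notin> perm_pow r s m J \<and> s + 1 \<in> perm_pow r s m J"
      and f = "\<lambda>m. fps_X ^ ell r s J m"] by (simp add: psi_term_def)
  ultimately show ?thesis by (simp add: Psi_def)
qed

text \<open>Splitting off the terms with \<open>m = 0\<close> leaves the sums for \<pi>(J), shifted
  by one power of \<open>Y\<close>, and by one power of \<open>X\<close> if
  \<open>1 \<in> J\<close>, since then every later exponent \<open>ell\<close> counts one
  more.\<close>

lemma Psi_rec:
  "Psi r s J = (if 1 \<in> J then SY else if s + 1 \<in> J then SY ^ (s + 1) else 0)
     + (if 1 \<in> J then SX else 1) * SY * Psi r s (perm r s ` J)" (is "_ = ?e + ?c * SY * ?P")
proof (rule fps_ext)
  fix n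
  show "fps_nth (Psi r s J) n = fps_nth (?e + ?c * SY * ?P) n"
  proof (cases n)
    case 0
    then show ?thesis by (simp add: Psi_nth psi_term_def fps_mult_nth_0)
  next
    case (Suc k)
    have "fps_nth (?c * SY * ?P) (Suc k) = (if 1 \<in> J then fps_X else 1) * fps_nth ?P k"
      by (simp add: mult.assoc)
    moreover have "fps_nth ?e (Suc k) =
      (if k = 0 \<and> 1 \<in> J then 1 else 0) + (if k = s \<and> 1 \<notin> J \<and> s + 1 \<in> J then 1 else 0)"
      by (simp add: fps_X_power_nth fps_X_nth)
    ultimately show ?thesis
      unfolding Suc fps_add_nth by (simp add: Psi_nth psi_term_Suc distrib_left)
  qed
qed

context kneading
begin

section \<open>How letters and their multiplicities pass to the sections of a word\<close>

lemma perm_range: "i \<in> {1..r} \<Longrightarrow> perm r s i \<in> {1..r}"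
  using s_pos s_less by (auto simp: perm_def)

lemma perm_inj: "inj_on (perm r s) {1..r}"
  using s_pos s_less by (auto simp: perm_def inj_on_def)

lemma perm_image: "perm r s ` {1..r} = {1..r}"
  using perm_range perm_inj by (intro card_subset_eq) (auto simp: card_image)

text \<open>The index on the right is the only one producing \<open>j\<close>: usually
  \<open>j + 1\<close>, but both \<open>s\<close> and \<open>r\<close> are produced by
  \<open>s + 1\<close>. Letter 1 produces nothing, although \<pi>(1) = s.\<close>

lemma count_letter_add:
  assumes "i \<in> {1..r}" "1 \<le> j"
  shows "count_list (letter i c) j + count_list (letter i (\<not> c)) j =
    (if i = (if j = r \<or> j = s then s + 1 else j + 1) then 1 else 0)"
proof -
  consider "i = 1" | "i = s + 1" | "i \<noteq> 1" "i \<noteq> s + 1" by blast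
  then show ?thesis
  proof cases
    case 1
    then show ?thesis using assms(2) s_pos by (simp add: letter_def)
  next
    case 2
    then show ?thesis using s_pos s_less by (cases "c = x i") (simp_all add: letter_def)
  next
    case 3
    then have "count_list (letter i c) j + count_list (letter i (\<not> c)) j = (if i - 1 = j then 1 else 0)"
      by (cases "c = x i") (simp_all add: letter_def)
    moreover have "i - 1 = j \<longleftrightarrow> i = (if j = r \<or> j = s then s + 1 else j + 1)"
      using 3 assms by auto
    ultimately show ?thesis by simp
  qed
qed

text \<open>Letters \<open>s\<close> and \<open>r\<close> arise only from \<open>s + 1\<close>,
  which puts them at opposite vertices.\<close>

lemma count_letter_s:
  assumes "i \<in> {1..r}"
  shows "count_list (letter i c) s = count_list (letter i (\<not> c)) r"
proof -
  consider "i = 1" | "i = s + 1" | "i \<noteq> 1" "i \<noteq> s + 1" by blast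
  then show ?thesis
  proof cases
    case 2
    then show ?thesis using s_pos s_less by (cases "c = x i") (simp_all add: letter_def)
  next
    case 3
    then have "i - 1 \<noteq> s" "i - 1 \<noteq> r" using assms by auto
    then show ?thesis using 3 by (simp add: letter_def)
  qed (simp add: letter_def)
qed

lemma count_sec_add:
  assumes "set L \<subseteq> {1..r}" "1 \<le> j"
  shows "count_list (sec c L) j + count_list (sec (\<not> c) L) j =
    count_list L (if j = r \<or> j = s then s + 1 else j + 1)"
proof -
  define k where "k = (if j = r \<or> j = s then s + 1 else j + 1)"
  have "count_list (sec c L) j + count_list (sec (\<not> c) L) j = count_list L k"
    using assms(1)
  proof (induction L)
    case (Cons i L)
    have "count_list (letter i (c \<noteq> sigma_odd L)) j + count_list (letter i ((\<not> c) \<noteq> sigma_odd L)) j =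
      (if i = k then 1 else 0)"
      using count_letter_add[of i j "c \<noteq> sigma_odd L"] Cons.prems assms(2) unfolding k_def[symmetric]
      by (cases "sigma_odd L") simp_all
    then show ?case
      using Cons by (cases "i = k") simp_all
  qed simp
  then show ?thesis unfolding k_def .
qed

lemma count_sec_s:
  assumes "set L \<subseteq> {1..r}"
  shows "count_list (sec c L) s = count_list (sec (\<not> c) L) r"
  using assms
proof (induction L)
  case (Cons i L)
  have "count_list (letter i (c \<noteq> sigma_odd L)) s = count_list (letter i ((\<not> c) \<noteq> sigma_odd L)) r"
    using count_letter_s[of i "c \<noteq> sigma_odd L"] Cons.prems by (cases "sigma_odd L") simp_all
  then show ?case
    using Cons by simp
qed simp

section \<open>Words whose letters of odd multiplicity move by \<pi>\<close>

lemma sigma_odd_no_1: "1 \<notin> set L \<Longrightarrow> \<not> sigma_odd L"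
  by (simp add: sigma_odd_def)

lemma sec_aligned:
  assumes "1 \<notin> set L" "\<forall>i\<in>set L. x i = c"
  shows "sec c L = map (perm r s) L \<and> sec (\<not> c) L = replicate (count_list L (s + 1)) s"
  using assms
proof (induction L)
  case (Cons i L)
  have "\<not> sigma_odd L" "i \<noteq> 1" "x i = c"
    using Cons.prems by (auto simp: sigma_odd_def)
  then show ?case
    using Cons by (auto simp: letter_def perm_def simp flip: Suc_eq_plus1)
qed simp

text \<open>If all letters have the same \<open>x\<close>-value, then
  \<open>sec (x (hd L)) L\<close> is the section that inherits them. For the empty word
  \<open>hd\<close> is unspecified, but both sections are empty.\<close>

definition next_word :: "nat list \<Rightarrow> nat list" where
  "next_word L = (if sigma_odd L then sec True L @ sec False L else sec (x (hd L)) L)"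

text \<open>Conditions (a) and (b) for a word at one time. Condition (a) is read modulo 2, whereas
  in the even case the requirement covers all letters, those of even multiplicity too, so that no
  letter but a by-product \<open>s\<close> leaves the chosen half.\<close>

definition steady :: "nat list \<Rightarrow> bool" where
  "steady L \<longleftrightarrow> set L \<subseteq> {1..r} \<and>
     (if sigma_odd L then odd (count_list L (s + 1))
      else 1 \<notin> set L \<and> (\<exists>c. \<forall>i\<in>set L. x i = c))"

definition odds :: "nat list \<Rightarrow> nat set" where
  "odds L = {i. odd (count_list L i)}"

lemma odds_subset: "odds L \<subseteq> set L"
  by (auto simp: odds_def intro: ccontr)

lemma one_in_odds: "1 \<in> odds L \<longleftrightarrow> sigma_odd L"
  by (simp add: odds_def sigma_odd_def)

lemma set_next_word: "set L \<subseteq> {1..r} \<Longrightarrow> set (next_word L) \<subseteq> {1..r}"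
  using set_sec by (simp add: next_word_def)

lemma steady_set: "steady L \<Longrightarrow> set L \<subseteq> {1..r}"
  unfolding steady_def by blast

lemma steady_odd: "steady L \<Longrightarrow> sigma_odd L \<Longrightarrow> odd (count_list L (s + 1))"
  by (simp add: steady_def)

lemma steady_aligned: "steady L \<Longrightarrow> \<not> sigma_odd L \<Longrightarrow> i \<in> set L \<Longrightarrow> j \<in> set L \<Longrightarrow> x i = x j"
  by (auto simp: steady_def)

lemma steady_no_1: "steady L \<Longrightarrow> \<not> sigma_odd L \<Longrightarrow> 1 \<notin> set L"
  by (simp add: steady_def)

lemma steady_even:
  assumes "steady L" "\<not> sigma_odd L"
  shows "next_word L = map (perm r s) L"
    and "sec (\<not> x (hd L)) L = replicate (count_list L (s + 1)) s"
proof -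
  have "\<forall>i\<in>set L. x i = x (hd L)"
    using steady_aligned[OF assms] by (metis list.set_sel(1) empty_iff empty_set)
  moreover have "1 \<notin> set L" using assms by (rule steady_no_1)
  ultimately show "next_word L = map (perm r s) L"
    and "sec (\<not> x (hd L)) L = replicate (count_list L (s + 1)) s"
    using sec_aligned[of L "x (hd L)"] assms(2) by (simp_all add: next_word_def)
qed

lemma count_next_word_odd:
  assumes "set L \<subseteq> {1..r}" "sigma_odd L" "i \<in> {1..r}"
  shows "count_list (next_word L) (perm r s i) = count_list L (if i = 1 then s + 1 else i)"
proof -
  have "count_list (next_word L) j = count_list L (if j = r \<or> j = s then s + 1 else j + 1)"
    if "1 \<le> j" for j
    using count_sec_add[OF assms(1) that, of True] assms(2) by (simp add: next_word_def)
  moreover have "1 \<le> perm r s i" using perm_range[OF assms(3)] by simp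
  ultimately show ?thesis
    using assms(3) s_pos s_less by (auto simp: perm_def)
qed

lemma count_map_inj:
  assumes "inj_on f A" "set L \<subseteq> A" "i \<in> A"
  shows "count_list (map f L) (f i) = count_list L i"
  using assms(2)
proof (induction L)
  case (Cons j L)
  then have "f j = f i \<longleftrightarrow> j = i"
    using inj_on_eq_iff[OF assms(1)] assms(3) by simp
  then show ?case using Cons by simp
qed simp

text \<open>In the odd case the copies of \<open>s\<close> = \<pi>(1) stem from \<open>s + 1\<close>
  instead of 1. Steadiness makes both multiplicities odd, so modulo 2 the word still moves by
  \<pi>.\<close>

lemma odd_count_next_word:
  assumes "steady L" "i \<in> {1..r}"
  shows "odd (count_list (next_word L) (perm r s i)) \<longleftrightarrow> odd (count_list L i)"
proof (cases "sigma_odd L")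
  case True
  then show ?thesis
    using count_next_word_odd[OF steady_set[OF assms(1)] True assms(2)] steady_odd[OF assms(1) True]
    by (cases "i = 1") (simp_all flip: sigma_odd_def)
next
  case False
  then show ?thesis
    using count_map_inj[OF perm_inj steady_set[OF assms(1)] assms(2)] steady_even(1)[OF assms(1)]
    by simp
qed

lemma odds_next_word:
  assumes "steady L"
  shows "odds (next_word L) = perm r s ` odds L"
proof -
  have L: "set L \<subseteq> {1..r}" using assms by (rule steady_set)
  then have sub: "odds (next_word L) \<subseteq> perm r s ` {1..r}" "odds L \<subseteq> {1..r}"
    unfolding perm_image using odds_subset set_next_word by blast+
  have "perm r s i \<in> odds (next_word L) \<longleftrightarrow> i \<in> odds L" if "i \<in> {1..r}" for i
    using odd_count_next_word[OF assms that] by (simp add: odds_def)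
  then show ?thesis using sub by blast
qed

text \<open>Powers of \<open>b i\<close> with \<open>i \<le> s\<close> descend without side effects:
  each even step multiplies the quotient by \<open>Y\<close> and lowers the index, until
  \<open>b 1\<close> contributes \<open>Y\<close> for odd \<open>k\<close> and nothing for even
  \<open>k\<close>.\<close>

lemma reduced_replicate:
  "i \<in> {1..s} \<Longrightarrow> reduced (replicate k i) (if odd k then SY ^ i else 0)"
proof (induction i)
  case (Suc i)
  have set: "set (replicate k (Suc i)) \<subseteq> {1..r}"
    using Suc.prems s_less by (auto simp: set_replicate_conv_if)
  show ?case
  proof (cases "i = 0")
    case True
    have so: "sigma_odd (replicate k (Suc i)) \<longleftrightarrow> odd k"
      unfolding True by (induction k) (auto simp: One_nat_def)
    have sec: "sec c (replicate k (Suc i)) = []" for c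
      unfolding True by (induction k) (auto simp: letter_def One_nat_def)
    show ?thesis
    proof (cases "odd k")
      case odd: True
      then show ?thesis
        using reduced_odd[OF set, of 0] so sec reduced_Nil True by simp
    next
      case even: False
      then show ?thesis
        using reduced_even[OF set, of True 0 0] so sec reduced_Nil by simp
    qed
  next
    case False
    define c where "c = x (Suc i)"
    have no1: "1 \<notin> set (replicate k (Suc i))"
      using False by (auto simp: One_nat_def)
    have sec: "sec c (replicate k (Suc i)) = replicate k i" "sec (\<not> c) (replicate k (Suc i)) = []"
      using sec_aligned[OF no1, of c] Suc.prems False
      by (auto simp: c_def perm_def map_replicate count_list_0_iff One_nat_def)
    have "reduced (replicate k i) (if odd k then SY ^ i else 0)"
      using Suc False by auto
    then show ?thesis
      using reduced_even[OF set sigma_odd_no_1[OF no1], of c "if odd k then SY ^ i else 0" 0]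
        sec reduced_Nil by (auto split: if_splits)
  qed
qed simp

text \<open>The defect \<open>F n\<close> of the claimed identity is a multiple of \<open>Y\<close>
  times the next defect. It is thus divisible by every power of \<open>Y\<close> and
  vanishes.\<close>

lemma reduced_steady:
  assumes steady: "\<And>n. steady (L n)" and step: "\<And>n. L (Suc n) = next_word (L n)"
  shows "reduced (L n) (Psi r s (odds (L n)))"
proof -
  define F where "F n = (1 - 2 * SY) * Phi (ev (L n)) - 1 - (SX - 2) * Psi r s (odds (L n))" for n
  have set: "set (L n) \<subseteq> {1..r}" for n
    using steady by (rule steady_set)
  have rec: "F n = (if sigma_odd (L n) then SX else 1) * SY * F (Suc n)" for n
  proof (cases "sigma_odd (L n)")
    case True
    have "Phi (ev (L n)) = 1 + SX * SY * Phi (ev (L (Suc n)))"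
      using Phi_ev_odd[OF set True] True by (simp add: step next_word_def)
    moreover have "Psi r s (odds (L n)) = SY + SX * SY * Psi r s (odds (L (Suc n)))"
      using Psi_rec[of r s "odds (L n)"] True by (simp add: one_in_odds step odds_next_word steady)
    ultimately show ?thesis
      unfolding F_def using True by (simp add: algebra_simps del: fps_const_mult)
  next
    case False
    define k where "k = count_list (L n) (s + 1)"
    define g where "g = (if odd k then SY ^ s else 0)"
    have so: "s + 1 \<in> odds (L n) \<longleftrightarrow> odd k"
      by (simp add: odds_def k_def)
    \<comment> \<open>The other section is a power of \<open>b s\<close>; its quotient
      \<open>Y ^ s\<close> or 0 accounts for the second sum of \<Psi>.\<close>
    have g: "(1 - 2 * SY) * Phi (ev (replicate k s)) = 1 + (SX - 2) * g"
      using reduced_replicate[of s k] s_pos unfolding reduced_def g_def by auto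
    have "Phi (ev (L n)) = 1 + SY * (Phi (ev (L (Suc n))) + Phi (ev (replicate k s)))"
      using Phi_ev_even[OF set False, of "x (hd (L n))"] False steady_even(2)[OF steady False]
      by (simp add: step next_word_def k_def)
    then have "(1 - 2 * SY) * Phi (ev (L n)) = (1 - 2 * SY) +
        SY * ((1 - 2 * SY) * Phi (ev (L (Suc n))) + (1 - 2 * SY) * Phi (ev (replicate k s)))"
      by (simp add: algebra_simps)
    moreover have "Psi r s (odds (L n)) = SY * g + SY * Psi r s (odds (L (Suc n)))"
      using Psi_rec[of r s "odds (L n)"] False
      by (auto simp: one_in_odds step odds_next_word steady g_def so power_add)
    ultimately show ?thesis
      unfolding F_def g using False by (simp add: algebra_simps del: fps_const_mult)
  qed
  have "fps_nth (F n) k = 0" for n k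
  proof (induction k arbitrary: n)
    case 0
    show ?case by (subst rec) (simp add: fps_mult_nth_0)
  next
    case (Suc k)
    show ?case by (subst rec) (simp add: mult.assoc Suc)
  qed
  then have "F n = 0" by (simp add: fps_eq_iff)
  then show ?thesis
    unfolding reduced_def F_def by (simp add: algebra_simps)
qed

lemma admissible_steady:
  assumes steady: "\<And>n. steady (L n)" and step: "\<And>n. L (Suc n) = next_word (L n)"
  shows "admissible r s x (odds (L 0))"
proof -
  have pow: "perm_pow r s n (odds (L 0)) = odds (L n)" for n
    by (induction n) (simp_all add: step odds_next_word steady flip: image_image)
  have "1 \<in> odds (L n) \<longrightarrow> s + 1 \<in> odds (L n)" for n
    using steady_odd[OF steady] unfolding one_in_odds by (simp add: odds_def)
  moreover have "1 \<notin> odds (L n) \<longrightarrow> (\<forall>i\<in>odds (L n). \<forall>j\<in>odds (L n). x i = x j)" for n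
    using steady_aligned[OF steady] odds_subset unfolding one_in_odds by blast
  ultimately show ?thesis
    unfolding admissible_def pow by (intro allI conjI)
qed

end

section \<open>Reduction of arbitrary words\<close>

text \<open>In a residue class modulo \<open>s\<close> in which \<open>P\<close> fails once, it
  fails ever after; in any other class it holds throughout. The maximum over the finitely many
  classes gives a common bound.\<close>

lemma eventually_shift_closed:
  fixes P :: "nat \<Rightarrow> bool"
  assumes "0 < s" "\<And>n. P (n + s) \<Longrightarrow> P n"
  shows "\<exists>N. \<forall>n\<ge>N. P n \<longrightarrow> P (n + s)"
proof -
  have earlier: "P n" if "P (n + k * s)" for n k
    using that
  proof (induction k)
    case (Suc k)
    then show ?case using assms(2)[of "n + k * s"] by (simp add: algebra_simps)
  qed simp
  have "\<exists>N. \<forall>n\<ge>N. n mod s = d \<longrightarrow> P n \<longrightarrow> P (n + s)" for d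
  proof (cases "\<exists>m. m mod s = d \<and> \<not> P m")
    case True
    then obtain m where m: "m mod s = d" "\<not> P m" by blast
    have "\<not> P n" if n: "n \<ge> m" "n mod s = d" for n
    proof -
      obtain k where "n - m = s * k"
        using n m by (metis dvd_def mod_eq_dvd_iff_nat)
      then have "n = m + k * s" using n(1) by (simp add: mult.commute)
      then show ?thesis using earlier m(2) by blast
    qed
    then show ?thesis by blast
  next
    case False
    then show ?thesis by (metis mod_add_self2)
  qed
  then obtain N where N: "\<And>d n. n \<ge> N d \<Longrightarrow> n mod s = d \<Longrightarrow> P n \<Longrightarrow> P (n + s)"
    by metis
  have "P (n + s)" if "n \<ge> Max (N ` {..<s})" "P n" for n
  proof -
    have "N (n mod s) \<le> Max (N ` {..<s})"
      using assms(1) by (intro Max_ge) auto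
    then show ?thesis using N[of "n mod s" n] that by simp
  qed
  then show ?thesis by blast
qed

context kneading
begin

section \<open>The weight of a word and words of weight zero\<close>

definition weight :: "nat list \<Rightarrow> nat" where
  "weight L = length (filter (\<lambda>i. s < i) L)"

lemma weight_simps [simp]:
  "weight [] = 0" "weight (i # L) = (if s < i then Suc (weight L) else weight L)"
  "weight (K @ L) = weight K + weight L"
  by (simp_all add: weight_def)

lemma weight_eq_0_iff: "weight L = 0 \<longleftrightarrow> (\<forall>i\<in>set L. i \<le> s)"
  by (auto simp: weight_def filter_empty_conv not_less)

text \<open>A letter above \<open>s\<close> leaves exactly one letter above \<open>s\<close> at
  exactly one of the two vertices, and small letters leave none; in particular \<open>s + 1\<close>
  leaves \<open>r\<close> and \<open>s\<close> at different vertices.\<close>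

lemma weight_letter_add:
  assumes "i \<in> {1..r}"
  shows "weight (letter i c) + weight (letter i (\<not> c)) = (if s < i then 1 else 0)"
proof -
  consider "i = 1" | "i = s + 1" | "i \<noteq> 1" "i \<noteq> s + 1" by blast
  then show ?thesis
    using assms s_pos s_less by cases (auto simp: letter_def One_nat_def)
qed

lemma weight_sec_add:
  "set L \<subseteq> {1..r} \<Longrightarrow> weight (sec c L) + weight (sec (\<not> c) L) = weight L"
proof (induction L)
  case (Cons i L)
  have "weight (letter i (c \<noteq> sigma_odd L)) + weight (letter i ((\<not> c) \<noteq> sigma_odd L)) =
      (if s < i then 1 else 0)"
    using weight_letter_add[of i "c \<noteq> sigma_odd L"] Cons.prems by (cases "sigma_odd L") simp_all
  then show ?case
    using Cons by (cases "s < i") simp_all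
qed simp

text \<open>Letters up to \<open>s\<close> only lead to smaller letters, so words of weight 0 die out.\<close>

lemma sum_list_sec:
  assumes "set L \<subseteq> {1..s}"
  shows "sum_list (sec c L) + sum_list (sec (\<not> c) L) + length L \<le> sum_list L"
  using assms
proof (induction L)
  case (Cons i L)
  have "sum_list (letter i (c \<noteq> sigma_odd L)) + sum_list (letter i ((\<not> c) \<noteq> sigma_odd L)) + 1 \<le> i"
    using Cons.prems by (auto simp: letter_def)
  then show ?case
    using Cons by simp
qed simp

definition good :: "int poly poly \<Rightarrow> nat list \<Rightarrow> bool" where
  "good D L \<longleftrightarrow> (\<exists>g. reduced L g \<and> series_of_poly D * g \<in> range series_of_poly)"

lemma good_even:
  assumes "set L \<subseteq> {1..r}" "\<not> sigma_odd L" "good D (sec c L)" "good D (sec (\<not> c) L)"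
  shows "good D L"
proof -
  obtain g h where gh: "reduced (sec c L) g" "reduced (sec (\<not> c) L) h"
      "series_of_poly D * g \<in> range series_of_poly" "series_of_poly D * h \<in> range series_of_poly"
    using assms(3,4) unfolding good_def by blast
  have "SY * (series_of_poly D * g + series_of_poly D * h) \<in> range series_of_poly"
    by (intro range_series_of_poly_mult[OF SY_in_range_series_of_poly] range_series_of_poly_add gh)
  moreover have "SY * (series_of_poly D * g + series_of_poly D * h) = series_of_poly D * (SY * (g + h))"
    by (simp add: algebra_simps)
  ultimately show ?thesis
    unfolding good_def using reduced_even[OF assms(1,2) gh(1,2)] by metis
qed

lemma good_odd:
  assumes "set L \<subseteq> {1..r}" "sigma_odd L" "good D (sec True L @ sec False L)"
  shows "good D L"
proof -
  obtain g where g: "reduced (sec True L @ sec False L) g" "series_of_poly D * g \<in> range series_of_poly"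
    using assms(3) unfolding good_def by blast
  have "series_of_poly D * SY + SX * SY * (series_of_poly D * g) \<in> range series_of_poly"
    by (intro range_series_of_poly_add range_series_of_poly_mult[OF rangeI SY_in_range_series_of_poly]
        range_series_of_poly_mult[OF range_series_of_poly_mult[OF SX_in_range_series_of_poly
        SY_in_range_series_of_poly] g(2)])
  moreover have "series_of_poly D * SY + SX * SY * (series_of_poly D * g) = series_of_poly D * (SY + SX * SY * g)"
    by (simp add: algebra_simps)
  ultimately show ?thesis
    unfolding good_def using reduced_odd[OF assms(1,2) g(1)] by metis
qed

text \<open>The sum of the indices drops at every step until the word is empty, so the quotient is a
  polynomial and any \<open>D\<close> clears its denominator.\<close>

lemma good_weight_0:
  assumes "set L \<subseteq> {1..r}" "weight L = 0"
  shows "good D L"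
proof -
  have "set L \<subseteq> {1..s}"
    using assms by (auto simp: weight_eq_0_iff)
  then show ?thesis
  proof (induction "sum_list L" arbitrary: L rule: less_induct)
    case less
    have set: "set L \<subseteq> {1..r}" using less.prems s_less by auto
    have "weight L = 0"
      unfolding weight_eq_0_iff using less.prems by auto
    then have wt: "weight (sec c L) = 0" for c
      using weight_sec_add[OF set, of c] by simp
    have sub: "set (sec c L) \<subseteq> {1..s}" for c
      using set_sec[OF set, of c] wt[of c] by (auto simp: weight_eq_0_iff)
    show ?case
    proof (cases "L = []")
      case True
      then show ?thesis unfolding good_def using reduced_Nil by (intro exI[of _ 0]) simp
    next
      case False
      then have lt: "sum_list (sec True L) + sum_list (sec False L) < sum_list L"
        using sum_list_sec[OF less.prems, of True] by (cases L) simp_all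
      show ?thesis
      proof (cases "sigma_odd L")
        case True
        have "good D (sec True L @ sec False L)"
          by (rule less.hyps) (use lt sub in simp_all)
        then show ?thesis by (rule good_odd[OF set True])
      next
        case False
        have "good D (sec True L)" "good D (sec (\<not> True) L)"
          by (rule less.hyps; use lt sub in simp)+
        then show ?thesis by (rule good_even[OF set False])
      qed
    qed
  qed
qed

text \<open>Without letters 1 the vertex \<open>c\<close> is never moved, and apart from
  \<open>r\<close> and \<open>s\<close> a letter can only come from its successor, at the vertex
  chosen by \<open>x\<close>.\<close>

lemma sec_no_1_elim:
  assumes "set L \<subseteq> {1..r}" "1 \<notin> set L" "k \<in> set (sec c L)" "k \<noteq> r" "k \<noteq> s"
  shows "k + 1 \<in> set L \<and> x (k + 1) = c"
  using assms
proof (induction L)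
  case (Cons i L)
  have so: "\<not> sigma_odd L" "i \<noteq> 1" "i \<noteq> 0"
    using Cons.prems(1,2) by (auto simp: sigma_odd_def)
  from Cons.prems(3) consider "k \<in> set (letter i c)" | "k \<in> set (sec c L)"
    using so by auto
  then show ?case
  proof cases
    case 1
    then show ?thesis using so Cons.prems(4,5)
      by (cases "i = s + 1"; cases "c = x i") (auto simp: letter_def)
  next
    case 2
    then show ?thesis using Cons by simp
  qed
qed simp

text \<open>The large letter \<open>i\<close> hands its weight to the vertex \<open>x i\<close>.
  This is used in reverse: if one section has weight zero, all large letters point to the
  other.\<close>

lemma weight_sec_no_1:
  assumes "1 \<notin> set L" "i \<in> set L" "s < i" "i \<in> {1..r}" "x i \<noteq> c"
  shows "weight (sec (\<not> c) L) \<noteq> 0"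
  using assms
proof (induction L)
  case (Cons j L)
  have so: "\<not> sigma_odd L" using Cons.prems(1) by (auto simp: sigma_odd_def)
  show ?case
  proof (cases "i = j")
    case True
    then show ?thesis using so Cons.prems s_pos s_less
      by (cases "i = s + 1"; cases "c") (auto simp: letter_def)
  next
    case False
    then show ?thesis using Cons so by simp
  qed
qed simp

end

text \<open>
  A sequence of words in which the weight never drops.  Such a word generates letters \<open>s\<close> only at
  the times when it acts nontrivially on the first level, and these letters become letters \<open>1\<close>
  exactly \<open>s\<close> steps later.  Hence a nontrivial action at time \<open>n + s\<close> forces one at time \<open>n\<close>, so that
  these times are eventually periodic with period \<open>s\<close>, and then no letter can get lost any more.
\<close>

locale rigid_sequence = kneading +
  fixes L :: "nat \<Rightarrow> nat list"
  assumes letters: "set (L n) \<subseteq> {1..r}"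
    and weight_pos: "weight (L n) \<noteq> 0"
    and step_odd: "sigma_odd (L n) \<Longrightarrow> L (Suc n) = sec True (L n) @ sec False (L n)"
    and step_even: "\<not> sigma_odd (L n) \<Longrightarrow> \<exists>c. L (Suc n) = sec c (L n) \<and> weight (sec (\<not> c) (L n)) = 0"
begin

abbreviation cnt :: "nat \<Rightarrow> nat \<Rightarrow> nat" where
  "cnt n i \<equiv> count_list (L n) i"

abbreviation odd_at :: "nat \<Rightarrow> bool" where
  "odd_at n \<equiv> sigma_odd (L n)"

section \<open>Tracing letters along a sequence of constant weight\<close>

lemma cnt_odd:
  assumes "odd_at n" "1 \<le> j"
  shows "cnt (Suc n) j = cnt n (if j = r \<or> j = s then s + 1 else Suc j)"
  using count_sec_add[OF letters assms(2), of True n] step_odd[OF assms(1)]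
  unfolding Suc_eq_plus1 by simp

text \<open>Each \<open>s\<close> in one section is matched by an \<open>r\<close> in the other. At
  an even time the discarded section has weight zero, hence contains no \<open>r\<close>, and the
  kept section receives no \<open>s\<close>.\<close>

lemma cnt_s:
  "cnt (Suc n) s = (if odd_at n then cnt n (s + 1) else 0)"
proof (cases "odd_at n")
  case True
  then show ?thesis using cnt_odd[OF True, of s] s_pos by simp
next
  case False
  obtain c where c: "L (Suc n) = sec c (L n)" "weight (sec (\<not> c) (L n)) = 0"
    using step_even[OF False] by blast
  have "r \<notin> set (sec (\<not> c) (L n))"
    using c(2) s_less unfolding weight_eq_0_iff by auto
  then show ?thesis
    using False c(1) count_sec_s[OF letters, of c n] by simp
qed

lemma cnt_Suc_le:
  assumes "1 \<le> j" "j < s"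
  shows "cnt (Suc n) j \<le> cnt n (Suc j)"
proof (cases "odd_at n")
  case True
  then show ?thesis using cnt_odd[OF True, of j] assms s_less by simp
next
  case False
  obtain c where "L (Suc n) = sec c (L n)"
    using step_even[OF False] by blast
  then show ?thesis
    using count_sec_add[OF letters assms(1), of c n] assms s_less unfolding Suc_eq_plus1 by simp
qed

lemma cnt_shift_le:
  assumes "d < i" "i \<le> s"
  shows "cnt (n + d) (i - d) \<le> cnt n i"
  using assms(1)
proof (induction d)
  case (Suc d)
  have "cnt (Suc (n + d)) (i - Suc d) \<le> cnt (n + d) (Suc (i - Suc d))"
    using Suc.prems assms(2) by (intro cnt_Suc_le) auto
  then show ?case
    using Suc by (simp add: Suc_diff_Suc)
qed simp

lemma cnt_1_le: "cnt (n + s) 1 \<le> cnt (Suc n) s"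
  using cnt_shift_le[of "s - 1" s "Suc n"] s_pos by (simp add: One_nat_def)

lemma odd_at_backwards: "odd_at (n + s) \<Longrightarrow> odd_at n"
  using cnt_1_le[of n] cnt_s[of n] unfolding sigma_odd_def by (auto split: if_splits)

definition onset :: nat where
  "onset = (SOME N. \<forall>n\<ge>N. odd_at n \<longrightarrow> odd_at (n + s))"

lemma odd_at_forwards: "onset \<le> n \<Longrightarrow> odd_at n \<Longrightarrow> odd_at (n + s)"
  using someI_ex[OF eventually_shift_closed[of s odd_at, OF s_pos odd_at_backwards]]
  unfolding onset_def by blast

text \<open>Past \<open>onset\<close> the time \<open>n - s\<close> is even as well. Then no letter
  \<open>s\<close> arises one step after it, and hence no letter 1 is present at time
  \<open>n\<close>.\<close>

lemma no_1_at_even: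
  assumes "onset + s \<le> n" "\<not> odd_at n"
  shows "1 \<notin> set (L n)"
proof -
  obtain m where m: "n = m + s" "onset \<le> m"
    using assms(1) by (metis add_le_imp_le_right le_add_diff_inverse2 le_add2 le_trans)
  then have "\<not> odd_at m" using odd_at_forwards assms(2) by blast
  then have "cnt n 1 = 0"
    using cnt_1_le[of m] cnt_s[of m] m(1) by simp
  then show ?thesis by (simp add: count_list_0_iff)
qed

text \<open>A large letter pointing elsewhere would give weight to the discarded section. A small
  letter is traced back to its birth as \<open>s\<close> and forward to a letter 1 that periodicity
  guarantees, which shows that \<open>i - 1\<close> occurs in the kept section.\<close>

lemma aligned_at_even:
  assumes n: "onset + s \<le> n" and even: "\<not> odd_at n" and i: "i \<in> set (L n)"
    and c: "L (Suc n) = sec c (L n)" "weight (sec (\<not> c) (L n)) = 0"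
  shows "x i = c"
proof (cases "s < i")
  case True
  then show ?thesis
    using weight_sec_no_1[OF no_1_at_even[OF n even] i] c(2) letters i by blast
next
  case False
  have i1: "1 < i" "i \<le> s"
    using no_1_at_even[OF n even] i letters[of n] False
    by (force simp: le_less, simp)
  \<comment> \<open>One step before the birth of the \<open>s\<close> that becomes \<open>i\<close>
    at time \<open>n\<close>: the birth is at time \<open>Suc m\<close>, and the descent takes
    \<open>s - i\<close> steps.\<close>
  define m where "m = n - (s - i) - 1"
  have m: "n = Suc m + (s - i)" "onset \<le> m"
    using n i1 unfolding m_def by simp_all
  have "0 < cnt n i"
    using i by (simp add: count_list_0_iff neq0_conv[symmetric] del: neq0_conv)
  also have "cnt n i \<le> cnt (Suc m) s"
    using cnt_shift_le[of "s - i" s "Suc m"] i1 m(1) by simp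
  finally have "odd_at m"
    using cnt_s[of m] by (simp split: if_splits)
  then have "odd_at (m + s)"
    using odd_at_forwards m(2) by blast
  then have "0 < cnt (m + s) 1"
    unfolding sigma_odd_def by (rule odd_pos)
  \<comment> \<open>The letter 1 at this time descends in \<open>i - 2\<close> steps from a letter
    \<open>i - 1\<close> at time \<open>Suc n\<close>.\<close>
  also have "m + s = Suc n + (i - 2)"
    using m(1) i1 by simp
  also have "cnt (Suc n + (i - 2)) 1 \<le> cnt (Suc n) (i - 1)"
    using cnt_shift_le[of "i - 2" "i - 1" "Suc n"] i1 by (simp add: numeral_2_eq_2 One_nat_def)
  finally have "i - 1 \<in> set (sec c (L n))"
    using c(1) by (metis count_list_0_iff less_irrefl)
  then show ?thesis
    using sec_no_1_elim[OF letters no_1_at_even[OF n even], of "i - 1" c] i1 s_less by simp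
qed

lemma cnt_Suc_eq:
  assumes n: "onset + s \<le> n" and j: "1 \<le> j" "j < s"
  shows "cnt (Suc n) j = cnt n (Suc j)"
proof (cases "odd_at n")
  case True
  then show ?thesis using cnt_odd[OF True j(1)] j s_less by simp
next
  case False
  obtain c where c: "L (Suc n) = sec c (L n)" "weight (sec (\<not> c) (L n)) = 0"
    using step_even[OF False] by blast
  have "L (Suc n) = map (perm r s) (L n)"
    using sec_aligned[OF no_1_at_even[OF n False], of c] aligned_at_even[OF n False _ c] c(1) by simp
  moreover have "perm r s (Suc j) = j"
    using j by (simp add: perm_def One_nat_def)
  ultimately show ?thesis
    using count_map_inj[OF perm_inj letters, of "Suc j"] j s_less by simp
qed

lemma cnt_shift_eq:
  assumes "onset + s \<le> n" "d < s"
  shows "cnt (n + d) (s - d) = cnt n s"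
  using assms(2)
proof (induction d)
  case (Suc d)
  have "cnt (Suc (n + d)) (s - Suc d) = cnt (n + d) (Suc (s - Suc d))"
    using Suc.prems assms(1) by (intro cnt_Suc_eq) auto
  then show ?case
    using Suc by (simp add: Suc_diff_Suc)
qed simp

text \<open>At an odd time the letters \<open>s + 1\<close> turn into letters \<open>s\<close>, and
  these reach 1 at time \<open>n + s\<close> without loss. That time is odd by periodicity, so the
  multiplicity of \<open>s + 1\<close> is odd.\<close>

lemma steady_eventually:
  assumes n: "onset + s \<le> n"
  shows "steady (L n)"
proof (cases "odd_at n")
  case True
  have "odd_at (n + s)"
    using n True by (intro odd_at_forwards) simp
  moreover have "cnt (n + s) 1 = cnt (Suc n) s"
    using cnt_shift_eq[of "Suc n" "s - 1"] n s_pos by (simp add: One_nat_def)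
  ultimately have "odd (cnt n (s + 1))"
    using True cnt_s[of n] by (simp add: sigma_odd_def)
  then show ?thesis
    using True letters unfolding steady_def by simp
next
  case False
  obtain c where c: "L (Suc n) = sec c (L n)" "weight (sec (\<not> c) (L n)) = 0"
    using step_even[OF False] by blast
  show ?thesis
    unfolding steady_def
    using False letters no_1_at_even[OF n False] aligned_at_even[OF n False _ c] by auto
qed

lemma next_word_eventually:
  assumes n: "onset + s \<le> n"
  shows "L (Suc n) = next_word (L n)"
proof (cases "odd_at n")
  case True
  then show ?thesis by (simp add: next_word_def step_odd)
next
  case False
  obtain c where c: "L (Suc n) = sec c (L n)" "weight (sec (\<not> c) (L n)) = 0"
    using step_even[OF False] by blast
  have "L n \<noteq> []" using weight_pos[of n] by auto
  then have "x (hd (L n)) = c"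
    using aligned_at_even[OF n False _ c] by simp
  then show ?thesis using False c(1) by (simp add: next_word_def)
qed

lemma eventually_reduced:
  obtains n J where "J \<subseteq> {1..r}" "admissible r s x J" "reduced (L n) (Psi r s J)"
proof -
  define K where "K n = L (onset + s + n)" for n
  have K: "steady (K n)" "K (Suc n) = next_word (K n)" for n
    unfolding K_def using steady_eventually next_word_eventually by simp_all
  have "odds (K 0) \<subseteq> {1..r}"
    using odds_subset steady_set[OF K(1)] by blast
  then show ?thesis
    using that admissible_steady[of K, OF K] reduced_steady[of K 0, OF K] unfolding K_def by blast
qed

end

section \<open>Descent on the weight for arbitrary words\<close>

context kneading
begin

text \<open>A bad word of minimal weight has a bad successor of the same weight: in the even case a
  bad section cannot be lighter, so the other section has weight zero. The resulting infinite
  sequence is rigid and reaches a word with quotient \<Psi>, which is good.\<close>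

lemma all_good:
  assumes D: "\<And>J. J \<subseteq> {1..r} \<Longrightarrow> admissible r s x J \<Longrightarrow> series_of_poly D * Psi r s J \<in> range series_of_poly"
    and L: "set L \<subseteq> {1..r}"
  shows "good D L"
  using L
proof (induction "weight L" arbitrary: L rule: less_induct)
  case less
  define bad where "bad K \<longleftrightarrow> set K \<subseteq> {1..r} \<and> weight K = weight L \<and> \<not> good D K" for K
  define succ where "succ K K' \<longleftrightarrow>
    (if sigma_odd K then K' = sec True K @ sec False K
     else (\<exists>c. K' = sec c K \<and> weight (sec (\<not> c) K) = 0))" for K K'
  have "\<exists>K'. bad K' \<and> succ K K'" if K: "bad K" for K
  proof -
    have set: "set K \<subseteq> {1..r}" and wt: "weight K = weight L" and nbad: "\<not> good D K"
      using K unfolding bad_def by blast+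
    have sum: "weight (sec c K) + weight (sec (\<not> c) K) = weight L" for c
      using weight_sec_add[OF set] wt by simp
    show ?thesis
    proof (cases "sigma_odd K")
      case True
      then have "bad (sec True K @ sec False K)"
        unfolding bad_def using good_odd[OF set True] nbad set_sec[OF set] sum[of True] by auto
      then show ?thesis using True unfolding succ_def by auto
    next
      case False
      then obtain c where c: "\<not> good D (sec c K)"
        using good_even[OF set False] nbad by blast
      then have "\<not> weight (sec c K) < weight L"
        using less.hyps set_sec[OF set] by blast
      then have "weight (sec c K) = weight L" "weight (sec (\<not> c) K) = 0"
        using sum[of c] by auto
      then show ?thesis
        using c False set_sec[OF set] unfolding bad_def succ_def by auto
    qed
  qed
  then have ex: "\<exists>f. f 0 = L \<and> (\<forall>n. bad (f n) \<and> succ (f n) (f (Suc n)))" if "bad L"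
    using dependent_nat_choice[of "\<lambda>n K. bad K \<and> (n = 0 \<longrightarrow> K = L)" "\<lambda>n. succ"] that by blast
  show ?case
  proof (rule ccontr)
    assume ng: "\<not> good D L"
    then have "bad L" using less.prems unfolding bad_def by simp
    then obtain f where f: "\<And>n. bad (f n)" "\<And>n. succ (f n) (f (Suc n))"
      using ex by blast
    have "weight L \<noteq> 0" using good_weight_0[OF less.prems] ng by blast
    then have "weight (f n) \<noteq> 0" "set (f n) \<subseteq> {1..r}" for n
      using f(1) unfolding bad_def by simp_all
    moreover have "sigma_odd (f n) \<Longrightarrow> f (Suc n) = sec True (f n) @ sec False (f n)"
      "\<not> sigma_odd (f n) \<Longrightarrow> \<exists>c. f (Suc n) = sec c (f n) \<and> weight (sec (\<not> c) (f n)) = 0" for n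
      using f(2)[of n] unfolding succ_def by simp_all
    ultimately interpret rigid_sequence r s x b f
      by unfold_locales
    obtain n J where J: "J \<subseteq> {1..r}" "admissible r s x J" "reduced (f n) (Psi r s J)"
      by (rule eventually_reduced)
    then have "good D (f n)" unfolding good_def using D by blast
    then show False using f(1) unfolding bad_def by blast
  qed
qed

end

section \<open>Denominators\<close>

text \<open>For \<open>k = r - s\<close> and \<open>n = s * (r - s)\<close> this is
  \<open>1 - (X ^ l * Y ^ s) ^ (r - s)\<close>.\<close>

definition cyclic_poly :: "nat \<Rightarrow> nat \<Rightarrow> nat \<Rightarrow> int poly poly" where
  "cyclic_poly k n l = 1 - PX ^ (l * k) * PY ^ n"

lemma coeff_cyclic_poly_0: "0 < n \<Longrightarrow> coeff (cyclic_poly k n l) 0 = 1"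
  by (simp add: cyclic_poly_def poly_0_coeff_0[symmetric] zero_power)

lemma PX_power: "PX ^ m = [:[:0, 1:] ^ m:]"
  by (induction m) (simp_all add: one_pCons)

lemma coprime_cyclic_poly:
  assumes "0 < k" "0 < n" "l \<noteq> l'"
  shows "coprime (cyclic_poly k n l) (cyclic_poly k n l')"
  using assms(3)
proof (induction l l' rule: linorder_wlog)
  case (le l l')
  define m where "m = l' * k - l * k"
  have m: "l' * k = m + l * k" "m \<noteq> 0"
    using le assms(1) unfolding m_def by auto
  \<comment> \<open>This combination is free of \<open>Y\<close>, hence coprime to anything in \<open>1 + Y \<int>[X,Y]\<close>.\<close>
  have eq: "[:[:0, 1:] ^ m - 1:] = PX ^ m * cyclic_poly k n l - cyclic_poly k n l'"
  proof -
    have "PX ^ m * cyclic_poly k n l - cyclic_poly k n l' = PX ^ m - 1"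
      unfolding cyclic_poly_def m(1) power_add by (simp only: algebra_simps)
    then show ?thesis by (simp add: PX_power one_pCons)
  qed
  have "poly ([:0, 1:] ^ m - 1 :: int poly) 0 \<noteq> 0"
    using m(2) by (simp add: zero_power)
  then have "([:0, 1:] ^ m - 1 :: int poly) \<noteq> 0" by (metis poly_0)
  then have cop: "coprime [:[:0, 1:] ^ m - 1:] (cyclic_poly k n l)"
    by (intro coprime_const_poly coeff_cyclic_poly_0 assms(2))
  show ?case
  proof (rule coprimeI)
    fix d assume d: "d dvd cyclic_poly k n l" "d dvd cyclic_poly k n l'"
    then have "d dvd [:[:0, 1:] ^ m - 1:]"
      unfolding eq by (intro dvd_diff dvd_mult)
    then show "d dvd 1" using cop d(1) by (metis coprime_common_divisor)
  qed
qed (metis coprime_commute)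

lemma prod_dvd_pairwise_coprime:
  fixes f :: "'i \<Rightarrow> 'a :: semiring_gcd"
  assumes "finite I" "\<And>i j. i \<in> I \<Longrightarrow> j \<in> I \<Longrightarrow> i \<noteq> j \<Longrightarrow> coprime (f i) (f j)"
    and "\<And>i. i \<in> I \<Longrightarrow> f i dvd a"
  shows "prod f I dvd a"
  using assms
proof (induction I rule: finite_induct)
  case (insert i I)
  then have "coprime (f i) (prod f I)"
    by (intro prod_coprime_right) auto
  then show ?case
    using insert by (auto intro!: divides_mult)
qed simp

lemma funpow_mult_fixed: "(f ^^ m) i = i \<Longrightarrow> (f ^^ (m * n)) i = i"
  by (induction n) (simp_all add: funpow_add)

lemma count_list_distinct: "distinct L \<Longrightarrow> count_list L i = (if i \<in> set L then 1 else 0)"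
  by (induction L) auto

section \<open>The cycles of \<pi> and a denominator for each \<Psi>\<close>

context kneading
begin

lemma perm_descend:
  assumes "j \<le> i" "\<And>k. j < k \<Longrightarrow> k \<le> i \<Longrightarrow> k \<noteq> 1 \<and> k \<noteq> s + 1"
  shows "(perm r s ^^ (i - j)) i = j"
  using assms
proof (induction "i - j" arbitrary: i)
  case (Suc d)
  then have "perm r s i = i - 1" "j \<le> i - 1" "d = i - 1 - j"
    by (auto simp: perm_def)
  then have "(perm r s ^^ d) (perm r s i) = j"
    using Suc.hyps(1)[of "i - 1"] Suc.prems by auto
  then show ?case using Suc.hyps(2) by (simp add: funpow_Suc_right flip: Suc.hyps(2) del: funpow.simps)
qed simp

text \<open>Descend from \<open>i\<close> to \<open>a\<close>, jump to \<open>c\<close>, and descend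
  back to \<open>i\<close>. This serves for the two cycles \<open>{1..s}\<close> and
  \<open>{s + 1..r}\<close>.\<close>

lemma perm_cycle:
  assumes "a \<le> i" "i \<le> c" "perm r s a = c" "0 < a" "\<And>k. a < k \<Longrightarrow> k \<le> c \<Longrightarrow> k \<noteq> 1 \<and> k \<noteq> s + 1"
  shows "(perm r s ^^ (c + 1 - a)) i = i"
proof -
  have "(perm r s ^^ (i - a)) i = a"
    using assms by (intro perm_descend) auto
  then have "(perm r s ^^ Suc (i - a)) i = c"
    using assms(3) by simp
  moreover have "(perm r s ^^ (c - i)) c = i"
    using assms by (intro perm_descend) auto
  ultimately have "(perm r s ^^ (c - i + Suc (i - a))) i = i"
    by (simp only: funpow_add comp_apply)
  moreover have "c - i + Suc (i - a) = c + 1 - a"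
    using assms by simp
  ultimately show ?thesis by metis
qed

lemma perm_period_low: "i \<in> {1..s} \<Longrightarrow> (perm r s ^^ s) i = i"
  using perm_cycle[of 1 i s] by (simp add: perm_def)

lemma perm_period_high: "i \<in> {s + 1..r} \<Longrightarrow> (perm r s ^^ (r - s)) i = i"
  using perm_cycle[of "s + 1" i r] s_pos by (simp add: perm_def)

lemma perm_period:
  assumes "i \<in> {1..r}"
  shows "(perm r s ^^ (s * (r - s))) i = i"
proof (cases "i \<le> s")
  case True
  then show ?thesis using assms by (intro funpow_mult_fixed perm_period_low) simp
next
  case False
  then have "(perm r s ^^ ((r - s) * s)) i = i"
    using assms by (intro funpow_mult_fixed perm_period_high) simp
  then show ?thesis by (simp add: mult.commute)
qed

lemma perm_pow_range: "i \<in> {1..r} \<Longrightarrow> (perm r s ^^ n) i \<in> {1..r}"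
  by (induction n) (simp_all add: perm_range del: atLeastAtMost_iff)

lemma perm_pow_inj: "inj_on (perm r s ^^ n) {1..r}"
  using perm_inj perm_image bij_betw_funpow unfolding bij_betw_def by blast

lemma perm_pow_le_s:
  assumes "i \<in> {1..r}"
  shows "(perm r s ^^ n) i \<le> s \<longleftrightarrow> i \<le> s"
proof (induction n)
  case (Suc n)
  have "perm r s j \<le> s \<longleftrightarrow> j \<le> s" if "j \<in> {1..r}" for j
    using that s_pos s_less by (auto simp: perm_def)
  then show ?case
    using Suc perm_pow_range[OF assms, of n] by simp
qed simp

text \<open>During one turn of the low cycle each element \<open>i + 1\<close> of
  \<open>{1..s}\<close> visits 1 exactly once, at time \<open>i\<close>.\<close>

lemma ell_s:
  assumes "J \<subseteq> {1..r}"
  shows "ell r s J s = card {i \<in> J. i \<le> s}"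
proof -
  have "1 \<in> perm_pow r s i J \<longleftrightarrow> i + 1 \<in> J" if "i < s" for i
  proof -
    have "(perm r s ^^ i) (i + 1) = 1"
      using perm_descend[of 1 "i + 1"] that by simp
    then show ?thesis
      using inj_on_image_mem_iff[OF perm_pow_inj, of "i + 1" J i] assms that s_less by auto
  qed
  then have "{i. i < s \<and> 1 \<in> perm_pow r s i J} = {i. i < s \<and> i + 1 \<in> J}" by blast
  moreover have "{i \<in> J. i \<le> s} = (\<lambda>i. i + 1) ` {i. i < s \<and> i + 1 \<in> J}"
  proof (intro equalityI subsetI)
    fix i assume "i \<in> {i \<in> J. i \<le> s}"
    moreover from this have "1 \<le> i" using assms by auto
    ultimately show "i \<in> (\<lambda>i. i + 1) ` {i. i < s \<and> i + 1 \<in> J}"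
      by (intro image_eqI[of _ _ "i - 1"]) auto
  qed auto
  ultimately show ?thesis
    unfolding ell_def by (simp add: card_image)
qed

lemma ell_mult_s:
  assumes "J \<subseteq> {1..r}"
  shows "ell r s J (s * m) = m * card {i \<in> J. i \<le> s}"
  using assms
proof (induction m arbitrary: J)
  case (Suc m)
  let ?J = "perm_pow r s s J"
  have J: "?J \<subseteq> {1..r}" using Suc.prems perm_pow_range by blast
  have eq: "(perm r s ^^ s) ` {i \<in> J. i \<le> s} = {i \<in> ?J. i \<le> s}"
    using Suc.prems perm_pow_le_s by blast
  have "inj_on (perm r s ^^ s) {i \<in> J. i \<le> s}"
    using Suc.prems by (intro inj_on_subset[OF perm_pow_inj]) blast
  from card_image[OF this] have card: "card {i \<in> ?J. i \<le> s} = card {i \<in> J. i \<le> s}"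
    unfolding eq .
  have "ell r s J (s * Suc m) = card {i \<in> J. i \<le> s} + m * card {i \<in> J. i \<le> s}"
    unfolding mult_Suc_right ell_add Suc.IH[OF J] ell_s[OF Suc.prems] card ..
  then show ?case by simp
qed simp

text \<open>Iterating the recursion \<open>n\<close> times only adds polynomial terms. Choosing
  \<open>n\<close> as a common period of the two cycles makes \<open>J\<close> return and yields a
  denominator.\<close>

lemma Psi_iterate:
  "Psi r s J - SX ^ ell r s J n * SY ^ n * Psi r s (perm_pow r s n J) \<in> range series_of_poly"
proof (induction n arbitrary: J)
  case (Suc n)
  let ?J = "perm r s ` J"
  define c where "c = (if 1 \<in> J then SX else 1)"
  define e where "e = (if 1 \<in> J then SY else if s + 1 \<in> J then SY ^ (s + 1) else 0)"
  have c: "c \<in> range series_of_poly" and e: "e \<in> range series_of_poly"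
    unfolding c_def e_def by (auto simp del: fps_const_power)
  have "e + c * SY * (Psi r s ?J - SX ^ ell r s ?J n * SY ^ n * Psi r s (perm_pow r s n ?J))
      \<in> range series_of_poly"
    by (intro range_series_of_poly_add e range_series_of_poly_mult[OF range_series_of_poly_mult[OF c]]
        SY_in_range_series_of_poly Suc.IH)
  also have "SX ^ ell r s J (Suc n) = c * SX ^ ell r s ?J n"
    unfolding ell_Suc c_def by (simp add: power_add del: fps_const_power)
  then have "e + c * SY * (Psi r s ?J - SX ^ ell r s ?J n * SY ^ n * Psi r s (perm_pow r s n ?J)) =
      Psi r s J - SX ^ ell r s J (Suc n) * SY ^ Suc n * Psi r s (perm_pow r s (Suc n) J)"
    unfolding Psi_rec[of r s J, folded c_def e_def] perm_pow_Suc by (simp add: algebra_simps)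
  finally show ?case .
qed simp

lemma cyclic_poly_Psi:
  assumes "J \<subseteq> {1..r}"
  shows "series_of_poly (cyclic_poly (r - s) (s * (r - s)) (card {i \<in> J. i \<le> s})) * Psi r s J
    \<in> range series_of_poly"
proof -
  let ?n = "s * (r - s)"
  have "perm_pow r s ?n J = J"
    using perm_period assms by (force simp: image_iff)
  moreover have "ell r s J ?n = card {i \<in> J. i \<le> s} * (r - s)"
    using ell_mult_s[OF assms] by simp
  ultimately show ?thesis
    using Psi_iterate[of J ?n] by (simp add: cyclic_poly_def left_diff_distrib)
qed

section \<open>The factors \<open>D_part\<close> and their coprimality\<close>

abbreviation Psis :: "nat \<Rightarrow> int fps fps set" where
  "Psis l \<equiv> {Psi r s J | J. J \<subseteq> {1..r} \<and> card {i \<in> J. i \<le> s} = l \<and> admissible r s x J}"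

text \<open>There are finitely many sets \<open>J\<close>, and \<open>cyclic_poly\<close> is a
  denominator for each; so the definite description in \<open>lcd\<close> does denote.\<close>

lemma is_lcd_D_part: "is_lcd (Psis l) (D_part r s x l)"
proof -
  have "Psis l \<subseteq> Psi r s ` Pow {1..r}" by blast
  then have "finite (Psis l)"
    by (rule finite_subset) simp
  moreover have "\<exists>E. coeff E 0 = 1 \<and> series_of_poly E * f \<in> range series_of_poly" if "f \<in> Psis l" for f
  proof -
    have "coeff (cyclic_poly (r - s) (s * (r - s)) l) 0 = 1"
      using s_pos s_less by (intro coeff_cyclic_poly_0) simp
    then show ?thesis
      using that cyclic_poly_Psi by blast
  qed
  ultimately obtain D where "is_lcd (Psis l) D"
    using ex_is_lcd by blast
  then show ?thesis
    unfolding D_part_def by (simp add: lcd_eqI)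
qed

lemma coeff_D_part_0: "coeff (D_part r s x l) 0 = 1"
  using is_lcd_D_part unfolding is_lcd_def by blast

lemma D_part_dvd_iff: "D_part r s x l dvd E \<longleftrightarrow> (\<forall>f\<in>Psis l. series_of_poly E * f \<in> range series_of_poly)"
proof -
  have "denominator_ideal (Psis l) = {E. D_part r s x l dvd E}"
    using is_lcd_D_part unfolding is_lcd_def by blast
  then show ?thesis unfolding denominator_ideal_def by blast
qed

lemma D_part_Psi:
  assumes "J \<subseteq> {1..r}" "admissible r s x J"
  shows "series_of_poly (D_part r s x (card {i \<in> J. i \<le> s})) * Psi r s J \<in> range series_of_poly"
  by (rule D_part_dvd_iff[THEN iffD1, OF dvd_refl, rule_format])
     (intro CollectI exI[of _ J] conjI refl assms)

lemma coprime_D_part: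
  assumes "l \<noteq> l'"
  shows "coprime (D_part r s x l) (D_part r s x l')"
proof -
  have "D_part r s x l dvd cyclic_poly (r - s) (s * (r - s)) l" for l
    unfolding D_part_dvd_iff by clarify (rule cyclic_poly_Psi)
  moreover have "coprime (cyclic_poly (r - s) (s * (r - s)) l) (cyclic_poly (r - s) (s * (r - s)) l')"
    using s_pos s_less assms by (intro coprime_cyclic_poly) auto
  ultimately show ?thesis by (metis coprime_divisors)
qed

section \<open>Realizing each \<Psi> by a group element\<close>

lemma admissible_perm: "admissible r s x J \<Longrightarrow> admissible r s x (perm r s ` J)"
  unfolding admissible_def perm_pow_Suc[symmetric] by blast

definition multiplicity_free :: "nat list \<Rightarrow> bool" where
  "multiplicity_free L \<longleftrightarrow> set L \<subseteq> {1..r} \<and> (\<forall>i. count_list L i \<le> 1) \<and> admissible r s x (odds L)"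

lemma steady_multiplicity_free:
  assumes "multiplicity_free L"
  shows "steady L"
proof -
  have sub: "set L \<subseteq> {1..r}" and le: "count_list L i \<le> 1" and adm: "admissible r s x (odds L)" for i
    using assms unfolding multiplicity_free_def by blast+
  have "odd (count_list L i)" if "i \<in> set L" for i
  proof -
    have "count_list L i = 1" using le[of i] that
      by (metis count_list_0_iff le_antisym less_one not_le)
    then show ?thesis by simp
  qed
  then have odds: "odds L = set L"
    using odds_subset by (auto simp: odds_def)
  have pow: "perm_pow r s 0 K = K" for K by simp
  have a: "1 \<in> odds L \<longrightarrow> s + 1 \<in> odds L"
    and b: "1 \<notin> odds L \<longrightarrow> (\<forall>i\<in>odds L. \<forall>j\<in>odds L. x i = x j)"
    using adm[unfolded admissible_def, THEN spec[of _ 0], unfolded pow] by (rule conjunct1, rule conjunct2)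
  show ?thesis
  proof (cases "sigma_odd L")
    case True
    then show ?thesis using a sub unfolding steady_def one_in_odds by (simp add: odds_def)
  next
    case False
    then have "\<forall>i\<in>set L. \<forall>j\<in>set L. x i = x j"
      using b[unfolded one_in_odds] unfolding odds by (rule rev_mp)
    then have "\<forall>i\<in>set L. x i = x (hd L)"
      by (metis list.set_sel(1) empty_iff empty_set)
    then have "\<exists>c. \<forall>i\<in>set L. x i = c" ..
    moreover have "1 \<notin> set L" using False odds one_in_odds by blast
    ultimately show ?thesis using False sub unfolding steady_def by simp
  qed
qed

text \<open>The multiplicities in the next word are multiplicities of letters of \<open>L\<close>,
  with \<open>s + 1\<close> taking the place of 1 in the odd case; so none exceeds 1.\<close>

lemma multiplicity_free_next_word:
  assumes "multiplicity_free L"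
  shows "multiplicity_free (next_word L)"
proof -
  have L: "set L \<subseteq> {1..r}" "\<And>i. count_list L i \<le> 1" "admissible r s x (odds L)" and steady: "steady L"
    using assms steady_multiplicity_free unfolding multiplicity_free_def by blast+
  have "count_list (next_word L) (perm r s i) \<le> 1" if "i \<in> {1..r}" for i
  proof (cases "sigma_odd L")
    case True
    then show ?thesis using count_next_word_odd[OF L(1) True that] L(2) by simp
  next
    case False
    then show ?thesis
      using steady_even(1)[OF steady False] count_map_inj[OF perm_inj L(1) that] L(2) by simp
  qed
  moreover have "j \<in> perm r s ` {1..r} \<or> count_list (next_word L) j = 0" for j
    unfolding perm_image using set_next_word[OF L(1)] by (auto simp: count_list_0_iff)
  ultimately have "count_list (next_word L) j \<le> 1" for j
    by (metis imageE zero_le)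
  then show ?thesis
    unfolding multiplicity_free_def odds_next_word[OF steady]
    using admissible_perm[OF L(3)] set_next_word[OF L(1)] by blast
qed

text \<open>The product of the \<open>b i\<close> with \<open>i \<in> J\<close>, in increasing
  order, stays multiplicity free and hence steady at all times.\<close>

lemma ex_reduced_Psi:
  assumes "J \<subseteq> {1..r}" "admissible r s x J"
  obtains L where "set L \<subseteq> {1..r}" "reduced L (Psi r s J)"
proof -
  define L where "L n = (next_word ^^ n) (sorted_list_of_set J)" for n
  have fin: "finite J" using assms(1) finite_subset by blast
  have count: "count_list (sorted_list_of_set J) i = (if i \<in> J then 1 else 0)" for i
    using fin by (simp add: count_list_distinct)
  then have odds: "odds (L 0) = J"
    by (auto simp: odds_def L_def)
  have "multiplicity_free (L n)" for n
  proof (induction n)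
    case 0
    have "set (L 0) \<subseteq> {1..r}" using assms(1) fin by (simp add: L_def)
    moreover have "count_list (L 0) i \<le> 1" for i
      using count[of i] by (simp add: L_def)
    ultimately show ?case
      unfolding multiplicity_free_def odds using assms(2) by blast
  next
    case (Suc n)
    then show ?case using multiplicity_free_next_word by (simp add: L_def)
  qed
  then have "steady (L n)" "L (Suc n) = next_word (L n)" for n
    using steady_multiplicity_free by (simp_all add: L_def)
  then have "reduced (L 0) (Psi r s (odds (L 0)))" "set (L 0) \<subseteq> {1..r}"
    using reduced_steady[of L 0] steady_set by blast+
  then show ?thesis using that odds by simp
qed

section \<open>The common denominator and its minimality\<close>

definition D_prod :: "int poly poly" where
  "D_prod = (\<Prod>l\<in>{0..s}. D_part r s x l)"

lemma D_prod_Psi: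
  assumes "J \<subseteq> {1..r}" "admissible r s x J"
  shows "series_of_poly D_prod * Psi r s J \<in> range series_of_poly"
proof -
  let ?l = "card {i \<in> J. i \<le> s}"
  have "{i \<in> J. i \<le> s} \<subseteq> {1..s}" using assms(1) by auto
  then have "?l \<le> card {1..s}" by (intro card_mono) auto
  then have "D_part r s x ?l dvd D_prod"
    unfolding D_prod_def by (intro dvd_prodI) auto
  then obtain E where "D_prod = E * D_part r s x ?l" by (metis dvdE mult.commute)
  then have "series_of_poly D_prod * Psi r s J =
      series_of_poly E * (series_of_poly (D_part r s x ?l) * Psi r s J)"
    by (simp add: mult.assoc)
  also have "\<dots> \<in> range series_of_poly"
    by (rule range_series_of_poly_mult[OF rangeI D_part_Psi[OF assms]])
  finally show ?thesis .
qed

lemma D_total_eq: "D_total r s x = (1 - 2 * PY) * D_prod"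
  by (simp add: D_total_def D_prod_def)

lemma coeff_D_total_0: "coeff (D_total r s x) 0 = 1"
  unfolding D_total_eq D_prod_def
  by (simp add: poly_0_coeff_0[symmetric] poly_prod)
     (simp add: poly_0_coeff_0 coeff_D_part_0)

lemma series_of_poly_linear_factors:
  "series_of_poly (1 - 2 * PY) = 1 - 2 * SY" "series_of_poly (PX - 2) = SX - 2"
  unfolding series_of_poly_diff series_of_poly_mult series_of_poly_1 series_of_poly_numeral
    series_of_poly_PX series_of_poly_PY by (rule refl)+

lemma D_total_Phi:
  assumes "set L \<subseteq> {1..r}"
  shows "series_of_poly (D_total r s x) * Phi (ev L) \<in> range series_of_poly"
proof -
  obtain g where g: "reduced L g" "series_of_poly D_prod * g \<in> range series_of_poly"
    using all_good[OF D_prod_Psi assms] unfolding good_def by blast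
  have "series_of_poly (D_total r s x) * Phi (ev L) = series_of_poly D_prod * ((1 - 2 * SY) * Phi (ev L))"
    unfolding D_total_eq series_of_poly_mult[of _ D_prod] series_of_poly_linear_factors
    by (simp only: mult_ac)
  also have "\<dots> = series_of_poly D_prod + (SX - 2) * (series_of_poly D_prod * g)"
    unfolding g(1)[unfolded reduced_def] by (simp add: algebra_simps)
  also have "\<dots> \<in> range series_of_poly"
    by (intro range_series_of_poly_add[OF rangeI range_series_of_poly_mult[OF _ g(2)]]
        range_series_of_poly_diff SX_in_range_series_of_poly numeral_in_range_series_of_poly)
  finally show ?thesis .
qed

text \<open>The identity element forces \<open>1 - 2 * PY\<close> to divide \<open>E\<close>. The
  elements realizing the \<Psi> then show that the cofactor \<open>N\<close> is a denominator of
  each \<Psi>, so all the pairwise coprime \<open>D_part\<close> divide it.\<close>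

lemma D_total_dvd:
  assumes E: "\<And>L. set L \<subseteq> {1..r} \<Longrightarrow> series_of_poly E * Phi (ev L) \<in> range series_of_poly"
  shows "D_total r s x dvd E"
proof -
  obtain N where "series_of_poly E * Phi id = series_of_poly N"
    using E[of "[]"] by auto
  then have "series_of_poly ((1 - 2 * PY) * N) = (1 - 2 * SY) * (series_of_poly E * Phi id)"
    unfolding series_of_poly_mult[of _ N] series_of_poly_linear_factors by simp
  also have "\<dots> = series_of_poly E * ((1 - 2 * SY) * Phi id)"
    by (simp add: mult_ac)
  finally have N: "E = (1 - 2 * PY) * N"
    by (simp only: Phi_id mult_1_right series_of_poly_eq_iff)
  have "D_part r s x l dvd N" for l
    unfolding D_part_dvd_iff
  proof clarify
    fix J assume J: "J \<subseteq> {1..r}" "admissible r s x J" "l = card {i \<in> J. i \<le> s}"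
    let ?D = "D_part r s x (card {i \<in> J. i \<le> s})"
    obtain L where L: "set L \<subseteq> {1..r}" "reduced L (Psi r s J)"
      using ex_reduced_Psi[OF J(1,2)] .
    obtain M where "series_of_poly M = series_of_poly E * Phi (ev L)"
      using E[OF L(1)] by (metis imageE)
    also have "\<dots> = series_of_poly N * ((1 - 2 * SY) * Phi (ev L))"
      unfolding N series_of_poly_mult[of _ N] series_of_poly_linear_factors by (simp only: mult_ac)
    also have "\<dots> = series_of_poly N + (SX - 2) * (series_of_poly N * Psi r s J)"
      unfolding L(2)[unfolded reduced_def] by (simp add: algebra_simps)
    finally have M: "series_of_poly (M - N) = (SX - 2) * (series_of_poly N * Psi r s J)"
      by simp
    obtain P where P: "series_of_poly ?D * Psi r s J = series_of_poly P"
      using D_part_Psi[OF J(1,2)] by blast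
    have "series_of_poly ((M - N) * ?D) = (SX - 2) * series_of_poly N * (series_of_poly ?D * Psi r s J)"
      unfolding series_of_poly_mult M by (simp only: mult_ac)
    also have "\<dots> = series_of_poly ((PX - 2) * (N * P))"
      unfolding P series_of_poly_mult[of "PX - 2"] series_of_poly_mult[of N]
        series_of_poly_linear_factors by (simp only: mult_ac)
    finally have "(M - N) * ?D = (PX - 2) * (N * P)"
      by (simp only: series_of_poly_eq_iff)
    then have "PX - 2 dvd (M - N) * ?D" by (metis dvd_triv_left)
    moreover have two: "PX - 2 = [:[:-2, 1:]:]"
      by (simp add: numeral_poly)
    then have "coprime (PX - 2) ?D"
      by (simp only:) (intro coprime_const_poly coeff_D_part_0, simp)
    ultimately have "PX - 2 dvd M - N"
      by (simp add: coprime_dvd_mult_left_iff)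
    then obtain R where "M - N = (PX - 2) * R" by (elim dvdE)
    then have "(SX - 2) * (series_of_poly N * Psi r s J) = (SX - 2) * series_of_poly R"
      using M by (simp only: series_of_poly_mult series_of_poly_linear_factors)
    moreover have "SX - 2 \<noteq> 0"
    proof -
      have "series_of_poly (PX - 2) \<noteq> series_of_poly 0"
        unfolding series_of_poly_eq_iff two by simp
      then show ?thesis unfolding series_of_poly_linear_factors series_of_poly_0 .
    qed
    ultimately have "series_of_poly N * Psi r s J = series_of_poly R"
      by (metis mult_left_cancel)
    then show "series_of_poly N * Psi r s J \<in> range series_of_poly" by simp
  qed
  then have "D_prod dvd N"
    unfolding D_prod_def by (intro prod_dvd_pairwise_coprime coprime_D_part) auto
  then show ?thesis
    unfolding D_total_eq N by (rule mult_dvd_mono[OF dvd_refl])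
qed

lemma is_lcd_D_total: "is_lcd (Phi ` Gam r b) (D_total r s x)"
proof -
  have "E \<in> denominator_ideal (Phi ` Gam r b) \<longleftrightarrow> D_total r s x dvd E" for E
  proof
    assume "E \<in> denominator_ideal (Phi ` Gam r b)"
    then show "D_total r s x dvd E"
      unfolding denominator_ideal_def Gam_eq by (intro D_total_dvd) blast
  next
    assume "D_total r s x dvd E"
    then obtain K where K: "E = K * D_total r s x" by (metis dvdE mult.commute)
    have "series_of_poly E * Phi (ev L) \<in> range series_of_poly" if "set L \<subseteq> {1..r}" for L
      unfolding K series_of_poly_mult mult.assoc
      by (rule range_series_of_poly_mult[OF rangeI D_total_Phi[OF that]])
    then show "E \<in> denominator_ideal (Phi ` Gam r b)"
      unfolding denominator_ideal_def Gam_eq by blast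
  qed
  then show ?thesis
    unfolding is_lcd_def using coeff_D_total_0 by blast
qed

lemma Phi_rational:
  assumes "w \<in> Gam r b"
  shows "fps_nth (Phi w) 0 = 1 \<and> is_rational (Phi w)"
proof -
  obtain L where L: "w = ev L" "set L \<subseteq> {1..r}"
    using assms unfolding Gam_eq by blast
  have "D_total r s x \<noteq> 0"
    using coeff_D_total_0 by (metis coeff_0 zero_neq_one)
  then have "is_rational (Phi w)"
    unfolding is_rational_def L(1) using D_total_Phi[OF L(2)] by blast
  then show ?thesis
    using Phi_nth_0 length_ev[OF L(2)] L(1) by blast
qed

end

theorem theorem5p50:
  fixes r s :: nat and x :: "nat \<Rightarrow> bool" and b :: "nat \<Rightarrow> vertex \<Rightarrow> vertex"
  assumes "0 < s" and "s < r"
    and "recursion_relations r s x b"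
  shows "(\<forall>w\<in>Gam r b. fps_nth (Phi w) 0 = 1 \<and> is_rational (Phi w)) \<and>
         is_lcd (Phi ` Gam r b) (D_total r s x)"
proof -
  interpret kneading r s x b
    using assms by unfold_locales
  show ?thesis using Phi_rational is_lcd_D_total by blast
qed

end
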